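(* Let $R\subset\mathbb{C}^n$ be a bounded circular domain containing the origin and let $B:L^2(R)\to H^2(R)$ be the Bergman projection on $R$. For each nonnegative integer $N$, let $P_N$ be the space of complex-valued (not necessarily holomorphic) polynomial functions on $R$ of degree at most $N$ in the real coordinates, and let $HP_N$ be the space of holomorphic polynomial functions on $R$ of degree at most $N$. Then $B(P_N)=HP_N$ for each nonnegative integer $N$.
   Context: A domain (connected open set) $R\subset\mathbb{C}^n$ is circular (about the origin) if $e^{i\theta}z\in R$ for all $z\in R$ and all $\theta\in\mathbb{R}$. Write $z=(z_1,\dots,z_n)$ for the coordinates of $\mathbb{C}^n$, $x_j=\operatorname{Re} z_j$, $y_j=\operatorname{Im} z_j$. $L^2(R)$ is the space of complex-valued functions square-integrable with respect to Lebesgue measure $dV$, with inner product $\langle f,g\rangle=\int_R f\bar g\,dV$, and $H^2(R)$ is its closed subspace of holomorphic functions (the Bergman space). The Bergman projection $B$ is the orthogonal projection of $L^2(R)$ onto $H^2(R)$. For multi-indices $\alpha,\beta,\gamma$ and a nonnegative integer $N$, $$P_N=\Big\{\sum_{|\alpha|+|\beta|\le N}c_{\alpha,\beta}x^\alpha y^\beta : c_{\alpha,\beta}\in\mathbb{C}\Big\},\qquad HP_N=\Big\{\sum_{|\gamma|\le N}d_\gamma z^\gamma : d_\gamma\in\mathbb{C}\Big\},$$ viewed as functions on $R$. *)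

theory Defs
  imports "HOL-Analysis.Analysis"
begin

definition circular :: "(complex ^ 'n) set \<Rightarrow> bool" where
  "circular R \<longleftrightarrow> (\<forall>z\<in>R. \<forall>\<theta>::real. exp (\<i> * complex_of_real \<theta>) *s z \<in> R)"

text \<open>
  Functions on \<open>R\<close> are represented as total functions in \<^term>\<open>extensional R\<close>, so that two of
  them are equal iff they agree on \<open>R\<close>.
\<close>

text \<open>
  For open \<open>R\<close>, holomorphic means complex (Frechet) differentiable at every point; the
  derivative must be complex linear because \<^term>\<open>(f has_derivative f') F\<close> only demands that
  \<open>f'\<close> be real linear.
\<close>

definition holomorphic_on_Cn :: "(complex ^ 'n \<Rightarrow> complex) \<Rightarrow> (complex ^ 'n) set \<Rightarrow> bool" where
  "holomorphic_on_Cn f R \<longleftrightarrow>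
     (\<forall>z\<in>R. \<exists>f'. (f has_derivative f') (at z within R) \<and> (\<forall>c v. f' (c *s v) = c * f' v))"

text \<open>Elements of \<open>L2_space R\<close> are representatives, not classes modulo almost everywhere equality.\<close>

definition L2_space :: "(complex ^ 'n) set \<Rightarrow> (complex ^ 'n \<Rightarrow> complex) set" where
  "L2_space R = {f \<in> extensional R. f \<in> borel_measurable (lebesgue_on R) \<and>
                              integrable (lebesgue_on R) (\<lambda>z. (cmod (f z))\<^sup>2)}"

definition L2_inner ::
    "(complex ^ 'n) set \<Rightarrow> (complex ^ 'n \<Rightarrow> complex) \<Rightarrow> (complex ^ 'n \<Rightarrow> complex) \<Rightarrow> complex" where
  "L2_inner R f g = integral\<^sup>L (lebesgue_on R) (\<lambda>z. f z * cnj (g z))"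

definition bergman_space :: "(complex ^ 'n) set \<Rightarrow> (complex ^ 'n \<Rightarrow> complex) set" where
  "bergman_space R = {f \<in> L2_space R. holomorphic_on_Cn f R}"

text \<open>
  The orthogonal projection onto the closed subspace \<^term>\<open>bergman_space R\<close>. For open \<open>R\<close> the function \<open>g\<close>
  is unique as a function, not just almost everywhere, because a continuous function that vanishes
  almost everywhere on an open set vanishes there identically.
\<close>

definition bergman_projection ::
    "(complex ^ 'n) set \<Rightarrow> (complex ^ 'n \<Rightarrow> complex) \<Rightarrow> (complex ^ 'n \<Rightarrow> complex)" where
  "bergman_projection R =
     (\<lambda>f\<in>L2_space R. THE g. g \<in> bergman_space R \<and> (\<forall>h\<in>bergman_space R. L2_inner R (\<lambda>z. f z - g z) h = 0))"

text \<open>Multi-indices are functions \<^typ>\<open>'n \<Rightarrow> nat\<close>.\<close>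

definition mdeg :: "('n::finite \<Rightarrow> nat) \<Rightarrow> nat" where
  "mdeg \<alpha> = (\<Sum>j\<in>UNIV. \<alpha> j)"

lemma finite_mdeg_le: "finite {\<gamma> :: 'n::finite \<Rightarrow> nat. mdeg \<gamma> \<le> N}"
proof (rule finite_subset)
  have "\<gamma> j \<le> mdeg \<gamma>" for \<gamma> :: "'n \<Rightarrow> nat" and j
    unfolding mdeg_def by (rule member_le_sum) simp_all
  then show "{\<gamma> :: 'n \<Rightarrow> nat. mdeg \<gamma> \<le> N} \<subseteq> PiE UNIV (\<lambda>_. {..N})"
    unfolding PiE_UNIV_domain using order_trans by blast
  show "finite (PiE (UNIV :: 'n set) (\<lambda>_. {..N}))"
    by (rule finite_PiE) simp_all
qed

lemma finite_mdeg_pair_le: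
  "finite {(\<alpha> :: 'n::finite \<Rightarrow> nat, \<beta> :: 'n \<Rightarrow> nat). mdeg \<alpha> + mdeg \<beta> \<le> N}"
proof (rule finite_subset)
  show "{(\<alpha> :: 'n \<Rightarrow> nat, \<beta> :: 'n \<Rightarrow> nat). mdeg \<alpha> + mdeg \<beta> \<le> N}
          \<subseteq> {\<alpha>. mdeg \<alpha> \<le> N} \<times> {\<beta>. mdeg \<beta> \<le> N}"
    by auto
qed (intro finite_cartesian_product finite_mdeg_le)

definition poly_space :: "(complex ^ 'n) set \<Rightarrow> nat \<Rightarrow> (complex ^ 'n \<Rightarrow> complex) set" where
  "poly_space R N = {\<lambda>z\<in>R. \<Sum>(\<alpha>, \<beta>)\<in>{(\<alpha>, \<beta>). mdeg \<alpha> + mdeg \<beta> \<le> N}.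
              c \<alpha> \<beta> * complex_of_real ((\<Prod>j\<in>UNIV. Re (z $ j) ^ \<alpha> j) * (\<Prod>j\<in>UNIV. Im (z $ j) ^ \<beta> j))
            | c :: ('n \<Rightarrow> nat) \<Rightarrow> ('n \<Rightarrow> nat) \<Rightarrow> complex. True}"

definition hol_poly_space :: "(complex ^ 'n) set \<Rightarrow> nat \<Rightarrow> (complex ^ 'n \<Rightarrow> complex) set" where
  "hol_poly_space R N = {\<lambda>z\<in>R. \<Sum>\<gamma> | mdeg \<gamma> \<le> N. d \<gamma> * (\<Prod>j\<in>UNIV. (z $ j) ^ \<gamma> j)
             | d :: ('n \<Rightarrow> nat) \<Rightarrow> complex. True}"

end

theory Submission
  imports Defs "HOL-Complex_Analysis.Complex_Analysis"
begin

text \<open>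
  A monomial \<open>z\<^sup>\<alpha> cnj(z)\<^sup>\<beta>\<close> has weight \<open>|\<alpha>| - |\<beta>| \<le> N\<close> under the rotations \<open>z \<mapsto> wz\<close>, \<open>|w| = 1\<close>, which
  preserve \<open>R\<close> and Lebesgue measure. Hence it is orthogonal to every \<open>H\<close> in the Bergman space whose
  homogeneous components of degree at most \<open>N\<close> vanish: averaging over the rotations replaces \<open>H\<close> by
  the component of that weight, which vanishes near 0 and so, by analytic continuation, on all of
  \<open>R\<close>. Consequently \<open>f \<in> P\<^sub>N\<close> sees only the Taylor polynomial of degree \<open>N\<close> at 0 of a function in the
  Bergman space, and the projection of \<open>f\<close> onto the finite-dimensional space \<open>HP\<^sub>N\<close> is already its
  Bergman projection.

  Analytic continuation and circle averages only need holomorphy along complex lines, which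
  avoids regularity theory in several variables.
\<close>

section \<open>Holomorphy along complex lines\<close>

text \<open>The component of a given weight is extracted by a Cauchy integral: averaging H against
  weight |\<alpha>| - |\<beta>| amounts to integrating \<open>H (u *s z) * u ^ m / u ^ Suc N\<close>
  over the unit circle, with m = N - |\<alpha>| + |\<beta>|. The weight is at most N exactly when m
  is a natural number, so positive and negative weights are treated alike: for z near 0,
  \<open>H (u *s z)\<close> vanishes to order N + 1 at u = 0 and the integral is 0. The homogeneous
  expansion of h need not converge on all of R; hence this is shown near 0 only, and the integral,
  as a function of z, is continued to R.

  The main obstacle is that \<open>holomorphic_on_Cn\<close> gives pointwise Frechet derivatives and
  no power series. The Taylor terms are therefore defined by derivatives along lines through 0, and
  that they are polynomials has to be proved: growth and Liouville on coordinate lines, then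
  interpolation to combine the coordinates, then homogeneity to find the degree.

  As the projection is given by \<open>THE\<close>, an explicit candidate is produced and its
  uniqueness is part of the argument.\<close>

lemma continuous_on_vscale [continuous_intros]:
  fixes f :: "'a::topological_space \<Rightarrow> complex" and g :: "'a \<Rightarrow> complex ^ 'n"
  assumes "continuous_on S f" "continuous_on S g"
  shows "continuous_on S (\<lambda>x. f x *s g x)"
  unfolding vector_scalar_mult_def using assms by (intro continuous_intros)

lemma norm_vscale: "norm (c *s z) = cmod c * norm (z :: complex ^ 'n)"
  by (simp add: norm_vec_def L2_set_def norm_mult power_mult_distrib real_sqrt_mult
      flip: sum_distrib_left)

lemma bounded_linear_vscale_left: "bounded_linear (\<lambda>t. t *s (v :: complex ^ 'n))"
  unfolding linear_conv_bounded_linear[symmetric]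
  by (rule linearI) (simp_all add: vec_eq_iff algebra_simps)

text \<open>Morera: the integral over a triangle is exchanged with the one over \<open>g\<close> and
  then vanishes by Cauchy's theorem in t. Only joint continuity and holomorphy in t for each fixed w
  are asked for; continuity of the derivative of \<open>g\<close> permits the exchange.\<close>

lemma holomorphic_contour_integral_param:
  assumes S: "open S" and g: "valid_path g"
    and g': "continuous_on {0..1} (\<lambda>x. vector_derivative g (at x))"
    and f: "continuous_on (S \<times> path_image g) (\<lambda>(t, w). f t w)"
    and hol: "\<And>w. w \<in> path_image g \<Longrightarrow> (\<lambda>t. f t w) holomorphic_on S"
  shows "(\<lambda>t. contour_integral g (f t)) holomorphic_on S"
proof -
  have gc: "continuous_on {0..1} g"
    using g by (auto simp: valid_path_def piecewise_C1_differentiable_on_def)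
  have im: "g x \<in> path_image g" if "x \<in> {0..1}" for x
    using that by (auto simp: path_image_def)
  have cont: "continuous_on S (\<lambda>t. contour_integral g (f t))"
  proof -
    have "continuous_on (S \<times> cbox 0 1) (\<lambda>p. (\<lambda>(t, w). f t w) (fst p, g (snd p)))"
      by (rule continuous_on_compose2[OF f])
        (auto intro!: continuous_intros continuous_on_compose2[OF gc] im)
    moreover have "continuous_on (S \<times> cbox 0 1) (\<lambda>p. vector_derivative g (at (snd p)))"
      by (rule continuous_on_compose2[OF g']) (auto intro!: continuous_intros)
    ultimately have "continuous_on (S \<times> cbox 0 1)
        (\<lambda>(t, x). f t (g x) * vector_derivative g (at x))"
      unfolding case_prod_unfold by (intro continuous_intros) simp_all
    from integral_continuous_on_param[OF this] show ?thesis
      unfolding contour_integral_integral by simp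
  qed
  have "(\<lambda>t. contour_integral g (f t)) analytic_on S"
  proof (rule Morera_triangle[OF cont S], intro impI)
    fix a b c assume hull: "convex hull {a, b, c} \<subseteq> S"
    have seg: "closed_segment a b \<subseteq> S" "closed_segment b c \<subseteq> S" "closed_segment c a \<subseteq> S"
      using hull by (meson order_trans segments_subset_convex_hull)+
    \<comment> \<open>Besides the exchange itself, integrability along \<open>g\<close> is required
      to put the three sides of the triangle under one integral sign.\<close>
    have swap: "contour_integral (linepath u v) (\<lambda>t. contour_integral g (f t)) =
        contour_integral g (\<lambda>w. contour_integral (linepath u v) (\<lambda>t. f t w))"
      and int: "(\<lambda>w. contour_integral (linepath u v) (\<lambda>t. f t w)) contour_integrable_on g"
      if "closed_segment u v \<subseteq> S" for u v
    proof -
      have fuv: "continuous_on (closed_segment u v \<times> path_image g) (\<lambda>(t, w). f t w)"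
        by (rule continuous_on_subset[OF f]) (use that in auto)
      show "contour_integral (linepath u v) (\<lambda>t. contour_integral g (f t)) =
        contour_integral g (\<lambda>w. contour_integral (linepath u v) (\<lambda>t. f t w))"
        by (rule contour_integral_swap) (use fuv g g' in auto)
      have "continuous_on ({0..1} \<times> cbox 0 1) (\<lambda>p. (\<lambda>(t, w). f t w) (linepath u v (snd p), g (fst p)))"
        by (rule continuous_on_compose2[OF fuv])
          (auto intro!: continuous_intros continuous_on_compose2[OF gc]
            continuous_on_compose2[OF continuous_on_linepath[of UNIV]] im linepath_in_path)
      then have "continuous_on ({0..1} \<times> cbox 0 1)
          (\<lambda>(y, x). f (linepath u v x) (g y) * vector_derivative (linepath u v) (at x))"
        unfolding case_prod_unfold by (intro continuous_intros) simp_all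
      from integral_continuous_on_param[OF this]
      have "continuous_on {0..1} (\<lambda>y. contour_integral (linepath u v) (\<lambda>t. f t (g y)))"
        unfolding contour_integral_integral by simp
      then show "(\<lambda>w. contour_integral (linepath u v) (\<lambda>t. f t w)) contour_integrable_on g"
        unfolding contour_integrable_on
        by (intro integrable_continuous_real continuous_on_mult g')
    qed
    have zero: "contour_integral (linepath a b) (\<lambda>t. f t w) + contour_integral (linepath b c) (\<lambda>t. f t w) +
        contour_integral (linepath c a) (\<lambda>t. f t w) = 0" if "w \<in> path_image g" for w
    proof -
      have ho: "(\<lambda>t. f t w) holomorphic_on S" using hol that .
      then have int: "(\<lambda>t. f t w) contour_integrable_on linepath u v" if "closed_segment u v \<subseteq> S" for u v
        using that by (intro contour_integrable_continuous_linepath)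
            (auto intro: holomorphic_on_imp_continuous_on continuous_on_subset)
      have "((\<lambda>t. f t w) has_contour_integral 0) (linepath a b +++ linepath b c +++ linepath c a)"
        by (rule Cauchy_theorem_triangle) (use ho hull in \<open>auto intro: holomorphic_on_subset\<close>)
      then have "contour_integral (linepath a b +++ linepath b c +++ linepath c a) (\<lambda>t. f t w) = 0"
        by (rule contour_integral_unique)
      then show ?thesis using int seg by (simp add: add.assoc)
    qed
    have "contour_integral g (\<lambda>w. contour_integral (linepath a b) (\<lambda>t. f t w)) +
          contour_integral g (\<lambda>w. contour_integral (linepath b c) (\<lambda>t. f t w)) +
          contour_integral g (\<lambda>w. contour_integral (linepath c a) (\<lambda>t. f t w)) =
          contour_integral g (\<lambda>w. contour_integral (linepath a b) (\<lambda>t. f t w) +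
             contour_integral (linepath b c) (\<lambda>t. f t w) + contour_integral (linepath c a) (\<lambda>t. f t w))"
      using int seg by (simp add: contour_integral_add contour_integrable_add)
    also have "\<dots> = contour_integral g (\<lambda>w. 0)"
      by (rule contour_integral_cong) (use zero in auto)
    finally show "contour_integral (linepath a b) (\<lambda>t. contour_integral g (f t)) +
       contour_integral (linepath b c) (\<lambda>t. contour_integral g (f t)) +
       contour_integral (linepath c a) (\<lambda>t. contour_integral g (f t)) = 0"
      using swap seg by simp
  qed
  then show ?thesis by (rule analytic_imp_holomorphic)
qed

lemma holomorphic_circlepath_param:
  assumes "open S" "0 \<le> s" "continuous_on (S \<times> sphere a s) (\<lambda>(t, w). f t w)"
    and "\<And>w. w \<in> sphere a s \<Longrightarrow> (\<lambda>t. f t w) holomorphic_on S"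
  shows "(\<lambda>t. contour_integral (circlepath a s) (f t)) holomorphic_on S"
proof (rule holomorphic_contour_integral_param)
  show "continuous_on {0..1} (\<lambda>x. vector_derivative (circlepath a s) (at x))"
    unfolding vector_derivative_circlepath by (intro continuous_intros)
qed (use assms in auto)

text \<open>Gateaux holomorphy together with continuity. This is the form in which one-variable
  theorems apply: continuity serves integration over circles, holomorphy along affine complex lines
  serves Morera and the identity theorem.\<close>

definition line_holomorphic_on :: "(complex ^ 'n \<Rightarrow> complex) \<Rightarrow> (complex ^ 'n) set \<Rightarrow> bool" where
  "line_holomorphic_on f R \<longleftrightarrow>
     continuous_on R f \<and> (\<forall>a v. (\<lambda>t. f (a + t *s v)) holomorphic_on {t. a + t *s v \<in> R})"

lemma open_line_preimage:
  fixes R :: "(complex ^ 'n) set"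
  assumes "open R" shows "open {t. a + t *s v \<in> R}"
proof -
  have "open ((\<lambda>t. a + t *s v) -` R)"
    by (rule open_vimage[OF assms]) (intro continuous_intros)
  then show ?thesis by (simp add: vimage_def)
qed

lemma holomorphic_on_Cn_imp_line_holomorphic_on:
  assumes R: "open R" and h: "holomorphic_on_Cn h R"
  shows "line_holomorphic_on h R"
  unfolding line_holomorphic_on_def
proof (intro conjI allI)
  show "continuous_on R h"
    unfolding continuous_on_eq_continuous_within
    using h by (auto simp: holomorphic_on_Cn_def intro: has_derivative_continuous)
  fix a v
  have "(\<lambda>t. h (a + t *s v)) field_differentiable (at t)" if tR: "a + t *s v \<in> R" for t
  proof -
    obtain h' where h': "(h has_derivative h') (at (a + t *s v))" "\<And>c u. h' (c *s u) = c * h' u"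
      using h tR unfolding holomorphic_on_Cn_def at_within_open[OF tR R, symmetric] by blast
    have "((\<lambda>t. a + t *s v) has_derivative (\<lambda>t. t *s v)) (at t)"
      using has_derivative_add[OF has_derivative_const
          bounded_linear_imp_has_derivative[OF bounded_linear_vscale_left]] by simp
    from diff_chain_at[OF this h'(1)]
    have "((\<lambda>t. h (a + t *s v)) has_derivative (\<lambda>t. h' v * t)) (at t)"
      by (simp add: o_def h'(2) mult.commute)
    then show ?thesis unfolding field_differentiable_def has_field_derivative_def by auto
  qed
  then show "(\<lambda>t. h (a + t *s v)) holomorphic_on {t. a + t *s v \<in> R}"
    unfolding holomorphic_on_def by (auto intro: field_differentiable_at_within)
qed

text \<open>The set of points near which f vanishes is open and relatively closed in the connected
  set R. Inside a ball, a zero neighbourhood of one point spreads to any other point along the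
  complex line through both, by the one-variable identity theorem.\<close>

lemma line_analytic_continuation:
  fixes f :: "complex ^ 'n \<Rightarrow> complex"
  assumes R: "open R" "connected R"
    and f: "\<And>a v. (\<lambda>t. f (a + t *s v)) holomorphic_on {t. a + t *s v \<in> R}"
    and z0: "z0 \<in> R" "eventually (\<lambda>z. f z = 0) (nhds z0)"
    and z: "z \<in> R"
  shows "f z = 0"
proof -
  define Z where "Z = {z \<in> R. eventually (\<lambda>z. f z = 0) (nhds z)}"
  have ball: "ball a r \<subseteq> Z" if sub: "ball a r \<subseteq> R" and b: "b \<in> ball a r" "b \<in> Z" for a b r
  proof -
    have zero: "f w = 0" if w: "w \<in> ball a r" for w
    proof -
      \<comment> \<open>The preimage of the ball rather than of R: it is convex, hence connected,
        and contains both t = 0 (the point b) and t = 1 (the point w).\<close>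
      define L where "L = {t. b + t *s (w - b) \<in> ball a r}"
      have "(\<lambda>t. f (b + t *s (w - b))) holomorphic_on L"
        unfolding L_def by (rule holomorphic_on_subset[OF f]) (use \<open>ball a r \<subseteq> R\<close> in auto)
      moreover have "open L" unfolding L_def by (rule open_line_preimage) simp
      moreover have "connected L"
      proof (rule convex_connected, rule convexI)
        fix s t :: complex and u v :: real
        assume st: "s \<in> L" "t \<in> L" and uv: "0 \<le> u" "0 \<le> v" "u + v = 1"
        have v: "v = 1 - u" using uv by simp
        have "b + (u *\<^sub>R s + v *\<^sub>R t) *s (w - b) =
            u *\<^sub>R (b + s *s (w - b)) + v *\<^sub>R (b + t *s (w - b))"
          unfolding v by (vector, simp add: algebra_simps scaleR_conv_of_real)
        then show "u *\<^sub>R s + v *\<^sub>R t \<in> L"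
          using st uv convexD[OF convex_ball, of "b + s *s (w - b)" a r "b + t *s (w - b)" u v]
          by (simp add: L_def)
      qed
      moreover have "eventually (\<lambda>t. f (b + t *s (w - b)) = 0) (nhds 0)"
      proof -
        have "((\<lambda>t. b + t *s (w - b)) \<longlongrightarrow> b + 0 *s (w - b)) (nhds 0)"
          by (rule continuous_on_tendsto_compose[where s = UNIV and f = "\<lambda>t. b + t *s (w - b)" and g = "\<lambda>t. t"])
            (auto intro!: continuous_intros filterlim_ident)
        then show ?thesis
          using \<open>b \<in> Z\<close> unfolding Z_def by (auto simp: filterlim_iff)
      qed
      then obtain U where U: "open U" "0 \<in> U" "\<And>t. t \<in> U \<Longrightarrow> f (b + t *s (w - b)) = 0"
        unfolding eventually_nhds by blast
      moreover have "0 \<in> L" "1 \<in> L" using b w by (auto simp: L_def)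
      ultimately have "f (b + 1 *s (w - b)) = 0"
        by (intro analytic_continuation[of "\<lambda>t. f (b + t *s (w - b))" L "U \<inter> L" 0 1])
          (auto intro: open_imp_islimpt)
      then show ?thesis by simp
    qed
    show ?thesis
    proof
      fix x assume x: "x \<in> ball a r"
      have "eventually (\<lambda>z. z \<in> ball a r) (nhds x)"
        using x by (intro eventually_nhds_in_open) auto
      then have "eventually (\<lambda>z. f z = 0) (nhds x)"
        by eventually_elim (rule zero)
      then show "x \<in> Z" using x \<open>ball a r \<subseteq> R\<close> by (auto simp: Z_def)
    qed
  qed
  have "open Z"
    unfolding open_contains_ball
  proof
    fix x assume x: "x \<in> Z"
    then obtain e where "e > 0" "ball x e \<subseteq> R"
      using R(1) by (auto simp: Z_def open_contains_ball)
    with ball[of x e x] x show "\<exists>e>0. ball x e \<subseteq> Z" by auto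
  qed
  moreover have "open (R - Z)"
    unfolding open_contains_ball
  proof
    fix x assume x: "x \<in> R - Z"
    then obtain e where e: "e > 0" "ball x e \<subseteq> R"
      using R(1) by (auto simp: open_contains_ball)
    \<comment> \<open>The same spreading gives closedness: a single point of Z in the ball would put
      the whole ball, its centre x included, into Z.\<close>
    have "ball x e \<subseteq> R - Z"
    proof (rule ccontr)
      assume "\<not> ball x e \<subseteq> R - Z"
      then obtain b where "b \<in> ball x e" "b \<in> Z" using e by auto
      then have "ball x e \<subseteq> Z" by (rule ball[OF e(2)])
      moreover have "x \<in> ball x e" using e(1) by simp
      ultimately show False using x by blast
    qed
    then show "\<exists>e>0. ball x e \<subseteq> R - Z" using e by auto
  qed
  moreover have "Z \<subseteq> R" "z0 \<in> Z" using z0 by (auto simp: Z_def)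
  ultimately have "R - Z = {}"
    using connectedD[OF R(2), of Z "R - Z"] z0 by auto
  then have "z \<in> Z" using z by auto
  then show ?thesis by (auto simp: Z_def dest: eventually_nhds_x_imp_x)
qed

section \<open>Graded spaces of polynomials\<close>

definition graded_span :: "('i \<Rightarrow> 'a \<Rightarrow> complex) \<Rightarrow> ('i \<Rightarrow> nat) \<Rightarrow> nat \<Rightarrow> ('a \<Rightarrow> complex) set" where
  "graded_span m deg N = {\<lambda>x. \<Sum>i | deg i \<le> N. c i * m i x | c. True}"

text \<open>The monomials form a monoid graded by \<open>deg\<close>, so the spans form a filtered
  algebra. Holomorphic, real and conjugate monomials share these closure rules.\<close>

locale graded_monomials =
  fixes m :: "'i \<Rightarrow> 'a \<Rightarrow> complex" and deg :: "'i \<Rightarrow> nat"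
  assumes finite_deg: "\<And>N. finite {i. deg i \<le> N}"
    and one: "\<exists>i. deg i = 0 \<and> m i = (\<lambda>x. 1)"
    and mult: "\<And>i j. \<exists>k. deg k = deg i + deg j \<and> m k = (\<lambda>x. m i x * m j x)"
begin

lemma base: "deg i \<le> N \<Longrightarrow> m i \<in> graded_span m deg N"
  unfolding graded_span_def
  by (auto intro!: exI[of _ "\<lambda>j. of_bool (j = i)"] simp: finite_deg)

lemma add: "f \<in> graded_span m deg N \<Longrightarrow> g \<in> graded_span m deg N \<Longrightarrow> (\<lambda>x. f x + g x) \<in> graded_span m deg N"
proof -
  assume "f \<in> graded_span m deg N" "g \<in> graded_span m deg N"
  then obtain c d where "f = (\<lambda>x. \<Sum>i | deg i \<le> N. c i * m i x)" "g = (\<lambda>x. \<Sum>i | deg i \<le> N. d i * m i x)"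
    unfolding graded_span_def by auto
  then have "(\<lambda>x. f x + g x) = (\<lambda>x. \<Sum>i | deg i \<le> N. (c i + d i) * m i x)"
    by (simp add: sum.distrib algebra_simps)
  then show ?thesis unfolding graded_span_def by (auto intro!: exI[of _ "\<lambda>i. c i + d i"])
qed

lemma scale: "f \<in> graded_span m deg N \<Longrightarrow> (\<lambda>x. a * f x) \<in> graded_span m deg N"
proof -
  assume "f \<in> graded_span m deg N"
  then obtain c where "f = (\<lambda>x. \<Sum>i | deg i \<le> N. c i * m i x)"
    unfolding graded_span_def by auto
  then have "(\<lambda>x. a * f x) = (\<lambda>x. \<Sum>i | deg i \<le> N. (a * c i) * m i x)"
    by (simp add: sum_distrib_left mult.assoc)
  then show ?thesis unfolding graded_span_def by (auto intro!: exI[of _ "\<lambda>i. a * c i"])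
qed

lemma zero: "(\<lambda>x. 0) \<in> graded_span m deg N"
  unfolding graded_span_def by (auto intro!: exI[of _ "\<lambda>i. 0"])

lemma sum: "(\<And>i. i \<in> I \<Longrightarrow> f i \<in> graded_span m deg N) \<Longrightarrow> (\<lambda>x. \<Sum>i\<in>I. f i x) \<in> graded_span m deg N"
  by (induction I rule: infinite_finite_induct) (auto intro: zero add)

lemma diff: "f \<in> graded_span m deg N \<Longrightarrow> g \<in> graded_span m deg N \<Longrightarrow> (\<lambda>x. f x - g x) \<in> graded_span m deg N"
  using add[OF _ scale[of g N "-1"]] by simp

lemma times:
  assumes "f \<in> graded_span m deg N" "g \<in> graded_span m deg M"
  shows "(\<lambda>x. f x * g x) \<in> graded_span m deg (N + M)"
proof -
  obtain c d where "f = (\<lambda>x. \<Sum>i | deg i \<le> N. c i * m i x)" "g = (\<lambda>x. \<Sum>i | deg i \<le> M. d i * m i x)"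
    using assms unfolding graded_span_def by auto
  then have "(\<lambda>x. f x * g x) = (\<lambda>x. \<Sum>i | deg i \<le> N. \<Sum>j | deg j \<le> M. (c i * d j) * (m i x * m j x))"
    by (simp add: sum_product algebra_simps)
  also have "\<dots> \<in> graded_span m deg (N + M)"
  proof (intro sum scale)
    fix i j assume ij: "i \<in> {i. deg i \<le> N}" "j \<in> {j. deg j \<le> M}"
    obtain k where k: "deg k = deg i + deg j" "m k = (\<lambda>x. m i x * m j x)" using mult by blast
    then show "(\<lambda>x. m i x * m j x) \<in> graded_span m deg (N + M)"
      using base[of k "N + M"] ij by simp
  qed
  finally show ?thesis .
qed

lemma const: "(\<lambda>x. a) \<in> graded_span m deg N"
proof -
  obtain i where "deg i = 0" "m i = (\<lambda>x. 1)" using one by blast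
  then show ?thesis using scale[OF base[of i N], of a] by simp
qed

lemma mono: "N \<le> M \<Longrightarrow> f \<in> graded_span m deg N \<Longrightarrow> f \<in> graded_span m deg M"
  using times[of f N "\<lambda>x. 1" "M - N"] const by simp

lemma prod:
  "finite I \<Longrightarrow> (\<And>i. i \<in> I \<Longrightarrow> f i \<in> graded_span m deg (n i)) \<Longrightarrow>
    (\<lambda>x. \<Prod>i\<in>I. f i x) \<in> graded_span m deg (\<Sum>i\<in>I. n i)"
  by (induction I rule: finite_induct) (auto intro: const times)

lemma power: "f \<in> graded_span m deg 1 \<Longrightarrow> (\<lambda>x. f x ^ k) \<in> graded_span m deg k"
  by (induction k) (auto intro: const dest: times)

lemma power_prod:
  "(\<And>i. f i \<in> graded_span m deg 1) \<Longrightarrow>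
    (\<lambda>x. \<Prod>i\<in>UNIV. f i x ^ \<gamma> i) \<in> graded_span m deg (mdeg (\<gamma> :: 'n::finite \<Rightarrow> nat))"
  unfolding mdeg_def by (intro prod power) auto

end

lemma graded_span_subset:
  assumes "graded_monomials m' deg'" "\<And>i. deg i \<le> N \<Longrightarrow> m i \<in> graded_span m' deg' N"
  shows "graded_span m deg N \<subseteq> graded_span m' deg' N"
proof -
  interpret graded_monomials m' deg' by fact
  show ?thesis
    unfolding graded_span_def[of m] using assms(2) by (auto intro!: sum scale)
qed

section \<open>The three families of monomials and their comparison\<close>

definition hol_monom :: "('n \<Rightarrow> nat) \<Rightarrow> complex ^ 'n \<Rightarrow> complex" where
  "hol_monom \<gamma> z = (\<Prod>j\<in>UNIV. (z $ j) ^ \<gamma> j)"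

definition real_monom :: "('n \<Rightarrow> nat) \<times> ('n \<Rightarrow> nat) \<Rightarrow> complex ^ 'n \<Rightarrow> complex" where
  "real_monom = (\<lambda>(\<alpha>, \<beta>) z.
     complex_of_real ((\<Prod>j\<in>UNIV. Re (z $ j) ^ \<alpha> j) * (\<Prod>j\<in>UNIV. Im (z $ j) ^ \<beta> j)))"

text \<open>Real monomials mix several weights; these products are eigenfunctions of the rotations,
  with factor \<open>w ^ mdeg \<alpha> * cnj w ^ mdeg \<beta>\<close>.\<close>

definition conj_monom :: "('n \<Rightarrow> nat) \<times> ('n \<Rightarrow> nat) \<Rightarrow> complex ^ 'n \<Rightarrow> complex" where
  "conj_monom = (\<lambda>(\<alpha>, \<beta>) z. hol_monom \<alpha> z * cnj (hol_monom \<beta> z))"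

definition mdeg2 :: "('n::finite \<Rightarrow> nat) \<times> ('n \<Rightarrow> nat) \<Rightarrow> nat" where
  "mdeg2 = (\<lambda>(\<alpha>, \<beta>). mdeg \<alpha> + mdeg \<beta>)"

lemma finite_mdeg2: "finite {i :: ('n::finite \<Rightarrow> nat) \<times> ('n \<Rightarrow> nat). mdeg2 i \<le> N}"
  using finite_mdeg_pair_le[of N] by (simp add: mdeg2_def case_prod_unfold)

interpretation hol: graded_monomials hol_monom mdeg
proof
  fix \<alpha> \<beta> :: "'n::finite \<Rightarrow> nat"
  show "\<exists>i. mdeg i = 0 \<and> hol_monom i = (\<lambda>z. 1)"
    by (rule exI[of _ "\<lambda>_. 0"]) (simp add: mdeg_def hol_monom_def fun_eq_iff)
  show "\<exists>k. mdeg k = mdeg \<alpha> + mdeg \<beta> \<and> hol_monom k = (\<lambda>z. hol_monom \<alpha> z * hol_monom \<beta> z)"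
    by (rule exI[of _ "\<lambda>j. \<alpha> j + \<beta> j"])
      (simp add: mdeg_def hol_monom_def fun_eq_iff sum.distrib prod.distrib power_add)
qed (rule finite_mdeg_le)

interpretation real: graded_monomials real_monom mdeg2
proof
  fix p q :: "('n::finite \<Rightarrow> nat) \<times> ('n \<Rightarrow> nat)"
  show "\<exists>i. mdeg2 i = 0 \<and> real_monom i = (\<lambda>z. 1)"
    by (rule exI[of _ "(\<lambda>_. 0, \<lambda>_. 0)"]) (simp add: mdeg_def mdeg2_def real_monom_def fun_eq_iff)
  show "\<exists>k. mdeg2 k = mdeg2 p + mdeg2 q \<and> real_monom k = (\<lambda>z. real_monom p z * real_monom q z)"
    by (rule exI[of _ "(\<lambda>j. fst p j + fst q j, \<lambda>j. snd p j + snd q j)"])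
      (simp add: mdeg_def mdeg2_def real_monom_def fun_eq_iff sum.distrib prod.distrib power_add
        case_prod_unfold mult_ac)
qed (rule finite_mdeg2)

interpretation conj: graded_monomials conj_monom mdeg2
proof
  fix p q :: "('n::finite \<Rightarrow> nat) \<times> ('n \<Rightarrow> nat)"
  show "\<exists>i. mdeg2 i = 0 \<and> conj_monom i = (\<lambda>z. 1)"
    by (rule exI[of _ "(\<lambda>_. 0, \<lambda>_. 0)"]) (simp add: mdeg_def mdeg2_def conj_monom_def hol_monom_def fun_eq_iff)
  show "\<exists>k. mdeg2 k = mdeg2 p + mdeg2 q \<and> conj_monom k = (\<lambda>z. conj_monom p z * conj_monom q z)"
    by (rule exI[of _ "(\<lambda>j. fst p j + fst q j, \<lambda>j. snd p j + snd q j)"])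
      (simp add: mdeg_def mdeg2_def conj_monom_def hol_monom_def fun_eq_iff sum.distrib prod.distrib
        power_add case_prod_unfold mult_ac)
qed (rule finite_mdeg2)

lemma mdeg_unit: "mdeg (\<lambda>i. of_bool (i = j)) = 1"
  by (simp add: mdeg_def)

lemma prod_unit: "(\<Prod>i\<in>UNIV. f i ^ of_bool (i = j)) = (f (j :: 'n::finite) :: 'a::comm_monoid_mult)"
proof -
  have "(\<Prod>i\<in>UNIV. f i ^ of_bool (i = j)) = (\<Prod>i\<in>UNIV. if i = j then f i else 1)"
    by (rule prod.cong) auto
  then show ?thesis by simp
qed

lemma mdeg_0: "mdeg (\<lambda>i. 0) = 0"
  by (simp add: mdeg_def)

lemma coord_hol: "(\<lambda>z. z $ j) \<in> graded_span hol_monom mdeg 1"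
  using hol.base[of "\<lambda>i. of_bool (i = j)" 1]
  by (simp add: mdeg_unit hol_monom_def[abs_def] prod_unit)

lemma coord_conj:
  "(\<lambda>z. z $ j) \<in> graded_span conj_monom mdeg2 1" "(\<lambda>z. cnj (z $ j)) \<in> graded_span conj_monom mdeg2 1"
  using conj.base[of "(\<lambda>i. of_bool (i = j), \<lambda>_. 0)" 1] conj.base[of "(\<lambda>_. 0, \<lambda>i. of_bool (i = j))" 1]
  by (simp_all add: mdeg_unit mdeg_0 mdeg2_def conj_monom_def hol_monom_def[abs_def] prod_unit)

lemma coord_real:
  "(\<lambda>z. of_real (Re (z $ j))) \<in> graded_span real_monom mdeg2 1"
  "(\<lambda>z. of_real (Im (z $ j))) \<in> graded_span real_monom mdeg2 1"
  using real.base[of "(\<lambda>i. of_bool (i = j), \<lambda>_. 0)" 1] real.base[of "(\<lambda>_. 0, \<lambda>i. of_bool (i = j))" 1]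
  by (simp_all add: mdeg_unit mdeg_0 mdeg2_def real_monom_def prod_unit)

lemma graded_span_hol_subset_real:
  "graded_span hol_monom mdeg N \<subseteq> graded_span real_monom mdeg2 N"
proof (rule graded_span_subset)
  fix \<gamma> :: "'n::finite \<Rightarrow> nat" assume "mdeg \<gamma> \<le> N"
  have "(\<lambda>z. of_real (Re (z $ j)) + \<i> * of_real (Im (z $ j))) \<in> graded_span real_monom mdeg2 1" for j :: 'n
    by (intro real.add real.scale coord_real)
  then have "(\<lambda>z. z $ j) \<in> graded_span real_monom mdeg2 1" for j :: 'n
    by (simp flip: complex_eq)
  then have "hol_monom \<gamma> \<in> graded_span real_monom mdeg2 (mdeg \<gamma>)"
    unfolding hol_monom_def[abs_def] by (rule real.power_prod)
  then show "hol_monom \<gamma> \<in> graded_span real_monom mdeg2 N"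
    by (rule real.mono[OF \<open>mdeg \<gamma> \<le> N\<close>])
qed (rule real.graded_monomials_axioms)

text \<open>Re and Im are linear in z and its conjugate, so passing to rotation eigenfunctions
  preserves the degree bound N, on which the bound for the weights rests.\<close>

lemma graded_span_real_subset_conj:
  "graded_span real_monom mdeg2 N \<subseteq> graded_span conj_monom mdeg2 N"
proof (rule graded_span_subset)
  fix p :: "('n::finite \<Rightarrow> nat) \<times> ('n \<Rightarrow> nat)" assume p: "mdeg2 p \<le> N"
  have "(\<lambda>z. (1 / 2) * (z $ j + cnj (z $ j))) \<in> graded_span conj_monom mdeg2 1"
       "(\<lambda>z. (- \<i> / 2) * (z $ j - cnj (z $ j))) \<in> graded_span conj_monom mdeg2 1" for j :: 'n
    by (intro conj.add conj.diff conj.scale coord_conj)+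
  moreover have "(1 / 2) * (w + cnj w) = of_real (Re w)" "(- \<i> / 2) * (w - cnj w) = of_real (Im w)" for w
    by (simp_all add: complex_eq_iff)
  ultimately have *: "(\<lambda>z. of_real (Re (z $ j))) \<in> graded_span conj_monom mdeg2 1"
       "(\<lambda>z. of_real (Im (z $ j))) \<in> graded_span conj_monom mdeg2 1" for j :: 'n
    by simp_all
  have "(\<lambda>z. (\<Prod>j\<in>UNIV. of_real (Re (z $ j)) ^ fst p j) * (\<Prod>j\<in>UNIV. of_real (Im (z $ j)) ^ snd p j))
      \<in> graded_span conj_monom mdeg2 (mdeg (fst p) + mdeg (snd p))"
    by (intro conj.times conj.power_prod *)
  then have "real_monom p \<in> graded_span conj_monom mdeg2 (mdeg2 p)"
    by (simp add: real_monom_def mdeg2_def case_prod_unfold)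
  then show "real_monom p \<in> graded_span conj_monom mdeg2 N"
    by (rule conj.mono[OF p])
qed (rule conj.graded_monomials_axioms)

lemma poly_space_eq: "poly_space R N = (\<lambda>f. restrict f R) ` graded_span real_monom mdeg2 N"
proof -
  have "restrict (\<lambda>z. \<Sum>i | mdeg2 i \<le> N. c i * real_monom i z) R \<in> poly_space R N" for c
    unfolding poly_space_def mdeg2_def real_monom_def
    by (auto intro!: exI[of _ "curry c"] simp: case_prod_unfold)
  moreover have "\<exists>d. (\<lambda>z. (\<Sum>(\<alpha>, \<beta>)\<in>{(\<alpha>, \<beta>). mdeg \<alpha> + mdeg \<beta> \<le> N}. c \<alpha> \<beta> *
      complex_of_real ((\<Prod>j\<in>UNIV. Re (z $ j) ^ \<alpha> j) * (\<Prod>j\<in>UNIV. Im (z $ j) ^ \<beta> j)))) =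
      (\<lambda>z. \<Sum>i | mdeg2 i \<le> N. d i * real_monom i z)" for c
    by (rule exI[of _ "case_prod c"]) (simp add: mdeg2_def real_monom_def case_prod_unfold)
  ultimately show ?thesis
    unfolding graded_span_def by (fastforce simp: poly_space_def image_iff)
qed

lemma hol_poly_space_eq: "hol_poly_space R N = (\<lambda>f. restrict f R) ` graded_span hol_monom mdeg N"
  unfolding hol_poly_space_def graded_span_def hol_monom_def by auto

text \<open>Both sides have degree at most k and agree at the k + 1 nodes 0, ..., k. It recovers a
  function polynomial in one coordinate from its restrictions to k + 1 fixed hyperplanes.\<close>

lemma lagrange_interpolation:
  fixes p :: "complex poly"
  assumes "degree p \<le> k"
  shows "poly p t = (\<Sum>i\<le>k. poly p (of_nat i) * (\<Prod>j\<in>{..k} - {i}. (t - of_nat j) / (of_nat i - of_nat j)))"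
proof -
  define b :: "nat \<Rightarrow> complex poly"
    where "b i = (\<Prod>j\<in>{..k} - {i}. smult (inverse (of_nat i - of_nat j)) [:- of_nat j, 1:])" for i
  define q where "q = (\<Sum>i\<le>k. smult (poly p (of_nat i)) (b i))"
  have b: "poly (b i) x = (\<Prod>j\<in>{..k} - {i}. (x - of_nat j) / (of_nat i - of_nat j))" for i x
    unfolding b_def poly_prod by (intro prod.cong) (auto simp: divide_inverse algebra_simps)
  have "degree (b i) \<le> k" if "i \<le> k" for i
  proof -
    have "degree (b i) \<le> (\<Sum>j\<in>{..k} - {i}. 1)"
      unfolding b_def by (rule order_trans[OF degree_prod_sum_le]) (auto intro!: sum_mono order_trans[OF degree_smult_le])
    also have "\<dots> = k" using that by simp
    finally show ?thesis .
  qed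
  then have "degree q \<le> k"
    unfolding q_def by (intro degree_sum_le) (auto intro: order_trans[OF degree_smult_le])
  have "poly (b i) (of_nat l) = of_bool (i = l)" if "l \<le> k" for i l
    unfolding b using that by (cases "i = l") (auto intro!: prod.neutral bexI[of _ l])
  then have q: "poly q (of_nat l) = poly p (of_nat l)" if "l \<le> k" for l
    using that by (simp add: q_def poly_sum)
  have "p = q"
  proof (rule poly_eqI_degree[where A = "of_nat ` {..k}"])
    have "card (of_nat ` {..k} :: complex set) = Suc k"
      by (subst card_image) (auto simp: inj_on_def)
    then show "degree p < card (of_nat ` {..k} :: complex set)" "degree q < card (of_nat ` {..k} :: complex set)"
      using assms \<open>degree q \<le> k\<close> by auto
  qed (use q in auto)
  then have "poly p t = poly q t" by simp
  then show ?thesis by (simp add: q_def poly_sum b)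
qed

text \<open>Induction on the set S of coordinates on which f depends: interpolation in one
  coordinate expresses f by functions of the remaining ones. The degree bound k is uniform in z, so
  the same nodes serve everywhere. The resulting degree M is crude.\<close>

lemma separately_polynomial_imp_polynomial:
  fixes f :: "complex ^ 'n \<Rightarrow> complex"
  assumes "finite S"
    and "\<And>z j. j \<in> S \<Longrightarrow> \<exists>p. degree p \<le> k \<and> (\<forall>t. f (z + t *s axis j 1) = poly p t)"
    and "\<And>z w. (\<forall>j\<in>S. z $ j = w $ j) \<Longrightarrow> f z = f w"
  shows "\<exists>M. f \<in> graded_span hol_monom mdeg M"
  using assms
proof (induction S arbitrary: f rule: finite_induct)
  case empty
  have "f z = f 0" for z by (rule empty.prems(2)) simp
  then have "f = (\<lambda>z. f 0)" by (rule ext)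
  then show ?case by (metis hol.const)
next
  case (insert j S)
  \<comment> \<open>Coordinate j is frozen at the node i, so \<open>g i\<close> depends on the
    coordinates in S only.\<close>
  define g where "g i z = f (z + (of_nat i - z $ j) *s axis j 1)" for i :: nat and z
  define l :: "nat \<Rightarrow> complex \<Rightarrow> complex"
    where "l i t = (\<Prod>j\<in>{..k} - {i}. (t - of_nat j) / (of_nat i - of_nat j))" for i t
  have "\<exists>M. g i \<in> graded_span hol_monom mdeg M" for i
  proof (rule insert.IH)
    fix z :: "complex ^ 'n" and j' assume j': "j' \<in> S"
    have "z + t *s axis j' 1 + (of_nat i - (z + t *s axis j' 1) $ j) *s axis j 1 =
        (z + (of_nat i - z $ j) *s axis j 1) + t *s axis j' 1" for t
      using insert.hyps j' by (auto simp: vec_eq_iff axis_def)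
    then have "g i (z + t *s axis j' 1) = f ((z + (of_nat i - z $ j) *s axis j 1) + t *s axis j' 1)" for t
      by (simp only: g_def)
    then show "\<exists>p. degree p \<le> k \<and> (\<forall>t. g i (z + t *s axis j' 1) = poly p t)"
      using insert.prems(1)[of j' "z + (of_nat i - z $ j) *s axis j 1"] j' by simp
  next
    fix z w :: "complex ^ 'n" assume "\<forall>j\<in>S. z $ j = w $ j"
    then show "g i z = g i w"
      unfolding g_def by (intro insert.prems(2)) (auto simp: axis_def)
  qed
  then obtain M where M: "\<And>i. g i \<in> graded_span hol_monom mdeg (M i)" by metis
  have l: "(\<lambda>z. l i (z $ j)) \<in> graded_span hol_monom mdeg (\<Sum>j\<in>{..k} - {i}. 1)" for i
    unfolding l_def
  proof (rule hol.prod)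
    fix r
    have "(\<lambda>z. inverse (of_nat i - of_nat r) * (z $ j - of_nat r)) \<in> graded_span hol_monom mdeg 1"
      by (intro hol.scale hol.diff hol.const coord_hol)
    then show "(\<lambda>z. (z $ j - of_nat r) / (of_nat i - of_nat r)) \<in> graded_span hol_monom mdeg 1"
      by (simp add: field_simps)
  qed simp
  have "f z = (\<Sum>i\<le>k. g i z * l i (z $ j))" for z
  proof -
    \<comment> \<open>The base point is moved to have j-th coordinate 0, so that the parameter t is
      the j-th coordinate itself.\<close>
    obtain p where p: "degree p \<le> k" "\<And>t. f ((z - (z $ j) *s axis j 1) + t *s axis j 1) = poly p t"
      using insert.prems(1)[of j "z - (z $ j) *s axis j 1"] by auto
    have "poly p (z $ j) = f z" using p(2)[of "z $ j"] by simp
    moreover have "poly p (of_nat i) = g i z" for i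
      using p(2)[of "of_nat i"] by (simp add: g_def vector_sub_rdistrib algebra_simps)
    ultimately show ?thesis
      using lagrange_interpolation[OF p(1), of "z $ j"] by (simp add: l_def)
  qed
  then have "f = (\<lambda>z. \<Sum>i\<le>k. g i z * l i (z $ j))" by auto
  also have "\<dots> \<in> graded_span hol_monom mdeg (\<Sum>i\<le>k. M i + (\<Sum>j\<in>{..k} - {i}. 1))"
  proof (rule hol.sum)
    fix i assume i: "i \<in> {..k}"
    show "(\<lambda>z. g i z * l i (z $ j)) \<in> graded_span hol_monom mdeg (\<Sum>i\<le>k. M i + (\<Sum>j\<in>{..k} - {i}. 1))"
      by (rule hol.mono[OF member_le_sum[OF i] hol.times[OF M l]]) auto
  qed
  finally show ?case ..
qed

lemma hol_monom_vscale: "hol_monom \<gamma> (t *s z) = t ^ mdeg \<gamma> * hol_monom \<gamma> z"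
  by (simp add: hol_monom_def mdeg_def power_mult_distrib prod.distrib power_sum)

text \<open>Comparing coefficients of t^k in f(tz) shows that f equals its part of degree k. This
  replaces a crude degree M by the true one.\<close>

lemma homogeneous_polynomial_degree:
  assumes f: "f \<in> graded_span hol_monom mdeg M"
    and hom: "\<And>t z. f (t *s z) = t ^ k * f z"
  shows "f \<in> graded_span hol_monom mdeg k"
proof -
  obtain d where d: "f = (\<lambda>z. \<Sum>\<gamma> | mdeg \<gamma> \<le> M. d \<gamma> * hol_monom \<gamma> z)"
    using f unfolding graded_span_def by auto
  have "f z = (\<Sum>\<gamma> | mdeg \<gamma> \<le> M. (if mdeg \<gamma> = k then d \<gamma> else 0) * hol_monom \<gamma> z)" for z
  proof -
    \<comment> \<open>f along the line spanned by z, as a polynomial in t; the coefficient of t^k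
      collects the monomials of degree k.\<close>
    define P where "P = (\<Sum>\<gamma> | mdeg \<gamma> \<le> M. monom (d \<gamma> * hol_monom \<gamma> z) (mdeg \<gamma>))"
    have "poly P t = poly (monom (f z) k) t" for t
    proof -
      have "poly P t = f (t *s z)"
        by (simp add: P_def poly_sum poly_monom d hol_monom_vscale mult_ac)
      then show ?thesis by (simp add: hom poly_monom mult.commute)
    qed
    then have "P = monom (f z) k" by (simp add: poly_eq_poly_eq_iff[symmetric] fun_eq_iff)
    then have "coeff P k = f z" by simp
    moreover have "coeff P k = (\<Sum>\<gamma> | mdeg \<gamma> \<le> M. (if mdeg \<gamma> = k then d \<gamma> else 0) * hol_monom \<gamma> z)"
      unfolding P_def coeff_sum by (intro sum.cong) auto
    ultimately show ?thesis by simp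
  qed
  then have "f = (\<lambda>z. \<Sum>\<gamma> | mdeg \<gamma> \<le> M. (if mdeg \<gamma> = k then d \<gamma> else 0) * hol_monom \<gamma> z)"
    by auto
  also have "\<dots> \<in> graded_span hol_monom mdeg k"
  proof (intro hol.sum)
    fix \<gamma> :: "'a \<Rightarrow> nat"
    show "(\<lambda>z. (if mdeg \<gamma> = k then d \<gamma> else 0) * hol_monom \<gamma> z) \<in> graded_span hol_monom mdeg k"
      by (cases "mdeg \<gamma> = k") (auto intro: hol.scale hol.base hol.zero)
  qed
  finally show ?thesis .
qed

section \<open>Taylor terms are polynomials\<close>

lemma line_holomorphic_on_subset:
  assumes "line_holomorphic_on f R" "S \<subseteq> R"
  shows "line_holomorphic_on f S"
  unfolding line_holomorphic_on_def
proof (intro conjI allI)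
  show "continuous_on S f"
    using assms continuous_on_subset unfolding line_holomorphic_on_def by blast
  show "(\<lambda>t. f (a + t *s v)) holomorphic_on {t. a + t *s v \<in> S}" for a v
    by (rule holomorphic_on_subset[of _ "{t. a + t *s v \<in> R}"])
      (use assms in \<open>auto simp: line_holomorphic_on_def\<close>)
qed

lemma line_holomorphic_on_diff:
  "line_holomorphic_on f R \<Longrightarrow> line_holomorphic_on g R \<Longrightarrow> line_holomorphic_on (\<lambda>z. f z - g z) R"
  unfolding line_holomorphic_on_def by (auto intro!: continuous_intros holomorphic_intros)

lemma line_holomorphic_onD:
  "line_holomorphic_on f R \<Longrightarrow> (\<lambda>t. f (t *s z)) holomorphic_on {t. t *s z \<in> R}"
  unfolding line_holomorphic_on_def by (metis (no_types, lifting) Collect_cong add_0 holomorphic_cong)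

text \<open>For fixed u the integrand is f along the line with base point \<open>u *s a\<close> and
  direction \<open>u *s v\<close>. It serves twice: with m = 0 for Cauchy's formula of a Taylor
  term, and with s = 1 for the rotation averages.\<close>

lemma line_holomorphic_circle_integral:
  fixes f :: "complex ^ 'n \<Rightarrow> complex"
  assumes f: "line_holomorphic_on f R" and S: "open S" and s: "0 < s"
    and sub: "\<And>t w. t \<in> S \<Longrightarrow> cmod w = s \<Longrightarrow> w *s (a + t *s v) \<in> R"
  shows "(\<lambda>t. contour_integral (circlepath 0 s) (\<lambda>u. f (u *s (a + t *s v)) * u ^ m / u ^ n)) holomorphic_on S"
proof (rule holomorphic_circlepath_param[OF S])
  have fc: "continuous_on R f" using f by (simp add: line_holomorphic_on_def)
  show "continuous_on (S \<times> sphere 0 s) (\<lambda>(t, u). f (u *s (a + t *s v)) * u ^ m / u ^ n)"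
    unfolding case_prod_unfold
    by (intro continuous_intros continuous_on_compose2[OF fc]) (use s sub in auto)
  fix w assume w: "w \<in> sphere (0 :: complex) s"
  have "(\<lambda>t. f (w *s a + t *s (w *s v))) holomorphic_on {t. w *s a + t *s (w *s v) \<in> R}"
    using f unfolding line_holomorphic_on_def by blast
  then have "(\<lambda>t. f (w *s a + t *s (w *s v))) holomorphic_on S"
    by (rule holomorphic_on_subset)
      (use sub w in \<open>auto simp: vector_add_ldistrib vector_smult_assoc mult.commute\<close>)
  then show "(\<lambda>t. f (w *s (a + t *s v)) * w ^ m / w ^ n) holomorphic_on S"
    using w s by (intro holomorphic_intros) (auto simp: vector_add_ldistrib vector_smult_assoc mult.commute)
qed (use s in simp)

text \<open>The homogeneous component of degree k at 0. Only the germ at t = 0 enters, so it makes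
  sense for every z, even where \<open>h z\<close> carries no information.\<close>

definition taylor_term :: "(complex ^ 'n \<Rightarrow> complex) \<Rightarrow> nat \<Rightarrow> complex ^ 'n \<Rightarrow> complex" where
  "taylor_term h k z = (deriv ^^ k) (\<lambda>t. h (t *s z)) 0 / fact k"

context
  fixes h :: "complex ^ 'n \<Rightarrow> complex" and r :: real
  assumes h: "line_holomorphic_on h (ball 0 r)" and r: "r > 0"
begin

lemma open_scale_preimage: "open {t. t *s (z :: complex ^ 'n) \<in> ball 0 r}"
  using open_line_preimage[of "ball 0 r" 0 z] by simp

lemma cball_scale_preimage:
  fixes z :: "complex ^ 'n"
  assumes "s * norm z < r" shows "cball 0 s \<subseteq> {t. t *s z \<in> ball 0 r}"
proof
  fix t :: complex assume "t \<in> cball 0 s"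
  then have "cmod t * norm z \<le> s * norm z" by (intro mult_right_mono) auto
  then show "t \<in> {t. t *s z \<in> ball 0 r}" using assms by (simp add: norm_vscale)
qed

text \<open>One radius s works for all z in a bounded set, which turns the derivative into an
  integral depending on a parameter. The factor \<open>u ^ 0\<close> matches the shape of
  \<open>line_holomorphic_circle_integral\<close>.\<close>

lemma taylor_term_contour_integral:
  assumes s: "s > 0" "s * norm z < r"
  shows "taylor_term h k z =
    1 / (2 * pi * \<i>) * contour_integral (circlepath 0 s) (\<lambda>u. h (u *s z) * u ^ 0 / u ^ Suc k)"
proof -
  have ho: "(\<lambda>t. h (t *s z)) holomorphic_on cball 0 s"
    using line_holomorphic_onD[OF h] cball_scale_preimage[OF s(2)] holomorphic_on_subset by blast
  have "contour_integral (circlepath 0 s) (\<lambda>u. h (u *s z) / (u - 0) ^ Suc k) =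
      (2 * pi * \<i>) * (deriv ^^ k) (\<lambda>t. h (t *s z)) 0 / fact k"
    by (rule Cauchy_contour_integral_circlepath)
      (use ho s in \<open>auto intro: holomorphic_on_imp_continuous_on holomorphic_on_subset\<close>)
  then show ?thesis by (simp add: taylor_term_def)
qed

lemma taylor_term_vscale: "taylor_term h k (t *s z) = t ^ k * taylor_term h k z"
proof -
  have "(deriv ^^ k) (\<lambda>u. (\<lambda>t. h (t *s z)) (t * u)) 0 = t ^ k * (deriv ^^ k) (\<lambda>t. h (t *s z)) (t * 0)"
  proof (rule higher_deriv_compose_linear[OF line_holomorphic_onD[OF h]])
    show "open {u. u *s (t *s z) \<in> ball 0 r}" "open {u. u *s z \<in> ball 0 r}"
      by (rule open_scale_preimage)+
  qed (use r in \<open>simp_all add: vector_smult_assoc mult.commute\<close>)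
  then show ?thesis by (simp add: taylor_term_def vector_smult_assoc mult.commute)
qed

text \<open>Cauchy's inequality with a bound C for h on the compact ball of radius r/2. B depends on
  k but not on z or \<rho>, as Liouville's theorem requires.\<close>

lemma taylor_term_bound:
  obtains B where "\<And>z \<rho>. \<rho> > 0 \<Longrightarrow> norm z \<le> \<rho> \<Longrightarrow> cmod (taylor_term h k z) \<le> B * \<rho> ^ k"
proof -
  have "compact (h ` cball 0 (r / 2))"
    using h r unfolding line_holomorphic_on_def
    by (intro compact_continuous_image) (auto elim!: continuous_on_subset)
  then obtain C where "\<forall>y\<in>h ` cball 0 (r / 2). cmod y \<le> C"
    using compact_imp_bounded[of "h ` cball 0 (r / 2)"] unfolding bounded_iff by blast
  then have C: "cmod (h z) \<le> C" if "norm z \<le> r / 2" for z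
    using that by simp
  show thesis
  proof (rule that)
    fix z :: "complex ^ 'n" and \<rho> :: real assume \<rho>: "\<rho> > 0" "norm z \<le> \<rho>"
    \<comment> \<open>The largest radius for which every z of norm at most \<rho> keeps the circle
      inside the ball of radius r/2.\<close>
    define s where "s = r / (2 * \<rho>)"
    have s: "s > 0" using \<rho> r by (simp add: s_def)
    have sz: "s * norm z \<le> r / 2"
      using mult_left_mono[OF \<rho>(2), of s] s \<rho>(1) by (simp add: s_def)
    have ho: "(\<lambda>t. h (t *s z)) holomorphic_on cball 0 s"
      using line_holomorphic_onD[OF h] cball_scale_preimage[of s z] sz r holomorphic_on_subset by fastforce
    have "cmod ((deriv ^^ k) (\<lambda>t. h (t *s z)) 0) \<le> fact k * C / s ^ k"
    proof (rule Cauchy_inequality[OF _ _ s])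
      fix x :: complex assume "cmod (0 - x) = s"
      then show "cmod (h (x *s z)) \<le> C" using sz by (intro C) (simp add: norm_vscale)
    qed (use ho in \<open>auto intro: holomorphic_on_imp_continuous_on holomorphic_on_subset\<close>)
    then have "cmod (taylor_term h k z) \<le> C / s ^ k"
      by (simp add: taylor_term_def norm_divide field_simps)
    also have "\<dots> = (C * (2 / r) ^ k) * \<rho> ^ k"
      using r \<rho> by (simp add: s_def field_simps)
    finally show "cmod (taylor_term h k z) \<le> (C * (2 / r) ^ k) * \<rho> ^ k" .
  qed
qed

text \<open>On each disc of parameters t a single small radius s makes Cauchy's formula valid, and
  the integral is holomorphic in t; the discs exhaust the plane.\<close>

lemma taylor_term_entire_on_lines: "(\<lambda>t. taylor_term h k (a + t *s v)) holomorphic_on UNIV"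
proof -
  have "(\<lambda>t. taylor_term h k (a + t *s v)) holomorphic_on ball 0 q" if "q > 0" for q
  proof -
    \<comment> \<open>M bounds \<open>a + t *s v\<close> on the disc, and its summand 1 keeps it
      positive even for a = v = 0. Then s * M = r/2 < r.\<close>
    define M where "M = norm a + q * norm v + 1"
    define s where "s = r / (2 * M)"
    have M: "M > 0" using \<open>q > 0\<close> by (auto simp: M_def intro!: add_nonneg_pos)
    have s: "s > 0" using M r by (simp add: s_def)
    have le: "norm (a + t *s v) \<le> M" if "t \<in> ball 0 q" for t
    proof -
      have "norm (t *s v) \<le> q * norm v"
        using that by (auto simp: norm_vscale intro!: mult_right_mono)
      then show ?thesis using norm_triangle_ineq[of a "t *s v"] by (simp add: M_def)
    qed
    have b: "s * norm (a + t *s v) < r" if "t \<in> ball 0 q" for t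
    proof -
      have "s * norm (a + t *s v) \<le> s * M" using s by (intro mult_left_mono le that) simp
      also have "s * M < r" using M r by (simp add: s_def)
      finally show ?thesis .
    qed
    have wb: "w *s (a + t *s v) \<in> ball 0 r" if "t \<in> ball 0 q" "cmod w = s" for t w
      using b that unfolding mem_ball_0 norm_vscale by simp
    have "(\<lambda>t. 1 / (2 * pi * \<i>) * contour_integral (circlepath 0 s) (\<lambda>u. h (u *s (a + t *s v)) * u ^ 0 / u ^ Suc k))
        holomorphic_on ball 0 q"
      by (intro holomorphic_intros line_holomorphic_circle_integral[OF h _ s])
        (use wb in auto)
    then show ?thesis
      by (rule holomorphic_transform) (use b s in \<open>auto simp: taylor_term_contour_integral\<close>)
  qed
  then have "(\<lambda>t. taylor_term h k (a + t *s v)) holomorphic_on (\<Union>q\<in>{0<..}. ball 0 q)"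
    by (intro holomorphic_on_UN_open) auto
  moreover have "(\<Union>q\<in>{0<..}. ball 0 q) = (UNIV :: complex set)"
  proof -
    have "t \<in> (\<Union>q\<in>{0<..}. ball 0 q)" for t :: complex
      by (rule UN_I[of "cmod t + 1"]) (simp_all add: add_nonneg_pos)
    then show ?thesis by blast
  qed
  ultimately show ?thesis by simp
qed

text \<open>Along every coordinate line the term is entire and grows like the \<open>k\<close>-th power, so Liouville's
  theorem makes it a polynomial there.\<close>

lemma taylor_term_polynomial: "taylor_term h k \<in> graded_span hol_monom mdeg k"
proof -
  obtain B where B: "\<And>z \<rho>. \<rho> > 0 \<Longrightarrow> norm z \<le> \<rho> \<Longrightarrow> cmod (taylor_term h k z) \<le> B * \<rho> ^ k"
    using taylor_term_bound[of k] by blast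
  have "\<exists>p. degree p \<le> k \<and> (\<forall>t. taylor_term h k (z + t *s axis j 1) = poly p t)" for z j
  proof -
    define f where "f t = taylor_term h k (z + t *s axis j 1)" for t
    \<comment> \<open>From this threshold on the argument has norm at most 2|t|; the summand 1 makes
      \<rho> = 2|t| positive.\<close>
    have "cmod (f t) \<le> (B * 2 ^ k) * cmod t ^ k" if "norm z + 1 \<le> cmod t" for t
    proof -
      have "norm (z + t *s axis j 1) \<le> norm z + cmod t"
        using norm_triangle_ineq[of z "t *s axis j 1"] by (simp add: norm_vscale)
      then have "norm (z + t *s axis j 1) \<le> 2 * cmod t" using that by simp
      moreover have "2 * cmod t > 0" using that norm_ge_zero[of z] by linarith
      ultimately show ?thesis using B[of "2 * cmod t" "z + t *s axis j 1"]
        by (simp add: f_def power_mult_distrib mult.assoc)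
    qed
    from Liouville_polynomial[of f, OF _ this]
    have f: "f t = (\<Sum>i\<le>k. (deriv ^^ i) f 0 / fact i * t ^ i)" for t
      using taylor_term_entire_on_lines unfolding f_def[abs_def] by blast
    have "degree (\<Sum>i\<le>k. monom ((deriv ^^ i) f 0 / fact i) i) \<le> k"
      by (intro degree_sum_le) (auto intro: order_trans[OF degree_monom_le])
    moreover have "f t = poly (\<Sum>i\<le>k. monom ((deriv ^^ i) f 0 / fact i) i) t" for t
      by (subst f) (simp add: poly_sum poly_monom)
    ultimately show ?thesis unfolding f_def[symmetric] by blast
  qed
  then obtain M where "taylor_term h k \<in> graded_span hol_monom mdeg M"
    using separately_polynomial_imp_polynomial[of UNIV k "taylor_term h k"] by (auto simp flip: vec_eq_iff)
  then show ?thesis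
    by (rule homogeneous_polynomial_degree) (rule taylor_term_vscale)
qed

text \<open>Along the line through z the remainder vanishes to order N + 1 at 0, so Cauchy's formula
  for the N-th derivative gives 0 for every m. As z lies in the ball, so does its multiple by any u
  in the closed unit disc.\<close>

lemma taylor_remainder_circle_integral:
  assumes z: "z \<in> ball 0 r"
  shows "contour_integral (circlepath 0 1)
    (\<lambda>u. (h (u *s z) - (\<Sum>k\<le>N. taylor_term h k (u *s z))) * u ^ m / u ^ Suc N) = 0"
proof -
  define T where "T = {t. t *s z \<in> ball 0 r}"
  define p where "p = (\<Sum>k\<le>N. monom (taylor_term h k z) k)"
  define \<psi> where "\<psi> t = h (t *s z) - poly p t" for t
  have T: "open T" "0 \<in> T" "cball 0 1 \<subseteq> T"
    unfolding T_def using open_scale_preimage[of z] r cball_scale_preimage[of 1 z] z by simp_all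
  have hT: "(\<lambda>t. h (t *s z)) holomorphic_on T"
    unfolding T_def by (rule line_holomorphic_onD[OF h])
  have \<psi>: "\<psi> holomorphic_on T"
    unfolding \<psi>_def[abs_def] by (intro holomorphic_intros hT)
  have dp: "(deriv ^^ j) (poly p) = poly ((pderiv ^^ j) p)" for j
    by (induction j) (auto simp: DERIV_imp_deriv[OF poly_DERIV])
  have \<psi>0: "(deriv ^^ j) \<psi> 0 = 0" if "j \<le> N" for j
  proof -
    have "(deriv ^^ j) \<psi> 0 = (deriv ^^ j) (\<lambda>t. h (t *s z)) 0 - (deriv ^^ j) (poly p) 0"
      unfolding \<psi>_def[abs_def] by (rule higher_deriv_diff[OF hT _ T(1,2)]) (intro holomorphic_intros)
    also have "(deriv ^^ j) (poly p) 0 = fact j * coeff p j"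
      by (simp add: dp poly_0_coeff_0 coeff_higher_pderiv pochhammer_fact)
    also have "coeff p j = taylor_term h j z"
      using that by (simp add: p_def coeff_sum)
    finally show ?thesis by (simp add: taylor_term_def)
  qed
  have "contour_integral (circlepath 0 1) (\<lambda>u. (\<psi> u * u ^ m) / (u - 0) ^ Suc N) =
      (2 * pi * \<i>) * (deriv ^^ N) (\<lambda>u. \<psi> u * u ^ m) 0 / fact N"
  proof (rule Cauchy_contour_integral_circlepath)
    have "(\<lambda>u. \<psi> u * u ^ m) holomorphic_on cball 0 1"
      by (intro holomorphic_intros holomorphic_on_subset[OF \<psi> T(3)])
    then show "continuous_on (cball 0 1) (\<lambda>u. \<psi> u * u ^ m)" "(\<lambda>u. \<psi> u * u ^ m) holomorphic_on ball 0 1"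
      by (auto intro: holomorphic_on_imp_continuous_on holomorphic_on_subset)
  qed simp
  \<comment> \<open>Leibniz' rule: every term contains a derivative of \<psi> at 0 of order at most
    N.\<close>
  also have "(deriv ^^ N) (\<lambda>u. \<psi> u * u ^ m) 0 =
      (\<Sum>i = 0..N. of_nat (N choose i) * (deriv ^^ i) \<psi> 0 * (deriv ^^ (N - i)) (\<lambda>u. u ^ m) 0)"
    by (rule higher_deriv_mult[OF \<psi> _ T(1,2)]) (intro holomorphic_intros)
  also have "\<dots> = 0" by (rule sum.neutral) (simp add: \<psi>0)
  finally show ?thesis
    by (simp add: \<psi>_def p_def poly_sum poly_monom taylor_term_vscale mult.commute)
qed

end

section \<open>Rotation invariance of Lebesgue measure\<close>

lemma nn_integral_lborel_translate:
  fixes F :: "'a::euclidean_space \<Rightarrow> ennreal"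
  assumes [measurable]: "F \<in> borel_measurable borel"
  shows "(\<integral>\<^sup>+x. F (c + x) \<partial>lborel) = (\<integral>\<^sup>+x. F x \<partial>lborel)"
  by (subst (2) lborel_distr_plus[of c, symmetric], subst nn_integral_distr) auto

lemma nn_integral_lborel_reflect:
  fixes F :: "'a::euclidean_space \<Rightarrow> ennreal"
  assumes [measurable]: "F \<in> borel_measurable borel"
  shows "(\<integral>\<^sup>+x. F (c - x) \<partial>lborel) = (\<integral>\<^sup>+x. F x \<partial>lborel)"
proof -
  have "lborel = distr lborel borel (\<lambda>x. c - x :: 'a)"
    using lborel_affine[of "-1" c] by (simp add: density_1)
  then have "(\<integral>\<^sup>+x. F x \<partial>lborel) = (\<integral>\<^sup>+x. F x \<partial>distr lborel borel (\<lambda>x. c - x))"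
    by simp
  also have "\<dots> = (\<integral>\<^sup>+x. F (c - x) \<partial>lborel)"
    by (subst nn_integral_distr) auto
  finally show ?thesis ..
qed

text \<open>Translation invariance determines the image measure up to a factor, by the Fubini argument for
  the uniqueness of Haar measure; the unit ball shows that the factor is 1.\<close>

lemma lborel_distr_isometry:
  fixes U :: "'a::euclidean_space \<Rightarrow> 'a"
  assumes U: "linear U" and norm: "\<And>x. norm (U x) = norm x"
  shows "distr lborel borel U = lborel"
proof (rule measure_eqI)
  have "inj U" using U norm
    by (metis linear_injective_0 norm_eq_zero)
  then have "surj U" using U linear_injective_imp_surjective by blast
  have [measurable]: "U \<in> borel_measurable borel"
    by (intro borel_measurable_continuous_onI linear_continuous_on) (use U linear_conv_bounded_linear in auto)
  fix A assume "A \<in> sets (distr lborel borel U)"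
  then have [measurable]: "A \<in> sets borel" by simp
  define B :: "'a set" where "B = ball 0 1"
  have [measurable]: "B \<in> sets borel" by (simp add: B_def)
  have "(\<integral>\<^sup>+x. indicator A (U x) \<partial>lborel) * emeasure lborel B
      = (\<integral>\<^sup>+x. indicator A (U x) * (\<integral>\<^sup>+y. indicator B (U x + y) \<partial>lborel) \<partial>lborel)"
    by (simp add: nn_integral_lborel_translate nn_integral_multc)
  also have "\<dots> = (\<integral>\<^sup>+x. (\<integral>\<^sup>+y. indicator A (U x) * indicator B (U x + y) \<partial>lborel) \<partial>lborel)"
    by (simp add: nn_integral_cmult)
  also have "\<dots> = (\<integral>\<^sup>+y. (\<integral>\<^sup>+x. indicator A (U x) * indicator B (U x + y) \<partial>lborel) \<partial>lborel)"
    by (rule lborel_pair.Fubini') measurable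
  also have "\<dots> = (\<integral>\<^sup>+y. (\<integral>\<^sup>+x. indicator A (U x - y) * indicator B (U x) \<partial>lborel) \<partial>lborel)"
  proof (rule nn_integral_cong)
    fix y
    \<comment> \<open>Translating x by a preimage of y moves y from the argument of B to that of A,
      where it can be integrated out alone.\<close>
    obtain v where v: "U v = y" using \<open>surj U\<close> by (metis surjD)
    have "(\<integral>\<^sup>+x. indicator A (U x - y) * indicator B (U x) \<partial>lborel)
        = (\<integral>\<^sup>+x. indicator A (U (v + x) - y) * indicator B (U (v + x)) \<partial>lborel :: ennreal)"
      by (rule nn_integral_lborel_translate[symmetric]) measurable
    also have "\<dots> = (\<integral>\<^sup>+x. indicator A (U x) * indicator B (U x + y) \<partial>lborel)"
      by (simp add: linear_add[OF U] v add.commute)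
    finally show "(\<integral>\<^sup>+x. indicator A (U x) * indicator B (U x + y) \<partial>lborel)
        = (\<integral>\<^sup>+x. indicator A (U x - y) * indicator B (U x) \<partial>lborel :: ennreal)" ..
  qed
  also have "\<dots> = (\<integral>\<^sup>+x. (\<integral>\<^sup>+y. indicator A (U x - y) * indicator B (U x) \<partial>lborel) \<partial>lborel)"
    by (rule lborel_pair.Fubini'[symmetric]) measurable
  also have "\<dots> = (\<integral>\<^sup>+x. emeasure lborel A * indicator B (U x) \<partial>lborel)"
    by (simp add: nn_integral_multc nn_integral_lborel_reflect)
  also have "\<dots> = emeasure lborel A * (\<integral>\<^sup>+x. indicator B x \<partial>lborel)"
  proof -
    have "indicator B (U x) = (indicator B x :: ennreal)" for x
      by (simp add: B_def norm indicator_def)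
    then show ?thesis by (simp add: nn_integral_cmult)
  qed
  also have "\<dots> = emeasure lborel A * emeasure lborel B"
    by simp
  finally have "(\<integral>\<^sup>+x. indicator A (U x) \<partial>lborel) * emeasure lborel B = emeasure lborel A * emeasure lborel B" .
  moreover have "(\<integral>\<^sup>+x. indicator A (U x) \<partial>lborel) = emeasure (distr lborel borel U) A"
    using nn_integral_distr[of U lborel borel "indicator A"] by simp
  moreover have "emeasure lborel B \<noteq> 0"
    using open_not_negligible[of B] by (auto simp: B_def negligible_iff_emeasure0)
  moreover have "emeasure lborel B \<noteq> \<infinity>"
    unfolding B_def using emeasure_lborel_ball_finite[of 0 1] by (simp add: less_top)
  ultimately show "emeasure (distr lborel borel U) A = emeasure lborel A"
    by (metis ennreal_mult_cancel_left infinity_ennreal_def mult.commute)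
qed simp

lemma sets_lebesgue_open: "open R \<Longrightarrow> R \<in> sets lebesgue"
  by (simp add: borel_open sets_completionI_sets)

text \<open>Passes from the completed measure to \<open>lborel\<close>, where Fubini's theorem and
  image measures are used. Continuity on the open set makes the extension by 0 Borel
  measurable.\<close>

lemma
  fixes F :: "'a::euclidean_space \<Rightarrow> complex"
  assumes R: "open R" and F: "continuous_on R F"
  shows integral_lebesgue_on_open: "integral\<^sup>L (lebesgue_on R) F = (LINT z|lborel. indicator R z *\<^sub>R F z)"
    and integrable_lebesgue_on_open: "integrable (lebesgue_on R) F \<longleftrightarrow> integrable lborel (\<lambda>z. indicator R z *\<^sub>R F z)"
proof -
  have m: "(\<lambda>z. indicator R z *\<^sub>R F z) \<in> borel_measurable lborel"
    using borel_measurable_continuous_on_indicator[OF _ F] R by auto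
  show "integral\<^sup>L (lebesgue_on R) F = (LINT z|lborel. indicator R z *\<^sub>R F z)"
    using integral_completion[OF m] sets_lebesgue_open[OF R] by (simp add: integral_restrict_space)
  show "integrable (lebesgue_on R) F \<longleftrightarrow> integrable lborel (\<lambda>z. indicator R z *\<^sub>R F z)"
    using integrable_completion[OF m] sets_lebesgue_open[OF R] by (simp add: integrable_restrict_space)
qed

lemma circular_vscale_iff:
  assumes R: "circular R" and w: "cmod w = 1"
  shows "w *s z \<in> R \<longleftrightarrow> z \<in> R"
proof -
  have *: "w *s z \<in> R" if "z \<in> R" "cmod w = 1" for w z
  proof -
    obtain \<theta> where "w = exp (\<i> * complex_of_real \<theta>)" using complex_norm_eq_1_exp \<open>cmod w = 1\<close> by metis
    then show ?thesis using R \<open>z \<in> R\<close> by (auto simp: circular_def)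
  qed
  show ?thesis
  proof
    assume "w *s z \<in> R"
    from *[OF this, of "inverse w"] w show "z \<in> R"
      by (cases "w = 0") (auto simp: norm_inverse vector_smult_assoc)
  qed (use * w in auto)
qed

text \<open>Rotation invariance lets the integral be averaged over \<theta>; after Fubini the inner
  integral is g(z) times the conjugate of a circle integral of H, up to a constant factor, and
  \<open>zero\<close> applies. \<open>m\<close> states a - b = N - m without subtraction of
  naturals.\<close>

lemma rotation_orthogonal:
  fixes g H :: "complex ^ 'n \<Rightarrow> complex"
  assumes R: "open R" "circular R"
    and g: "continuous_on R g" and H: "continuous_on R H"
    and int: "integrable (lebesgue_on R) (\<lambda>z. g z * cnj (H z))"
    and wt: "\<And>w z. cmod w = 1 \<Longrightarrow> g (w *s z) = w ^ a * cnj w ^ b * g z"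
    and m: "m + a = N + b"
    and zero: "\<And>z. z \<in> R \<Longrightarrow> contour_integral (circlepath 0 1) (\<lambda>u. H (u *s z) * u ^ m / u ^ Suc N) = 0"
  shows "integral\<^sup>L (lebesgue_on R) (\<lambda>z. g z * cnj (H z)) = 0"
proof -
  define w where "w = (\<lambda>\<theta>::real. exp (2 * of_real pi * \<i> * of_real \<theta>))"
  have w: "cmod (w \<theta>) = 1" for \<theta>
    by (simp add: w_def)
  have wc: "continuous_on T w" for T
    unfolding w_def by (intro continuous_intros)
  have wR: "w \<theta> *s z \<in> R \<longleftrightarrow> z \<in> R" for \<theta> z
    by (rule circular_vscale_iff[OF R(2) w])
  define G where "G z = g z * cnj (H z)" for z
  have Gc: "continuous_on R G" unfolding G_def by (intro continuous_intros g H)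
  define K where "K z = indicator R z *\<^sub>R G z" for z
  \<comment> \<open>Since R is rotation invariant, the rotated copies of K all live on R. The
    indicator of a product set then gives joint Borel measurability from continuity.\<close>
  define \<Phi> where "\<Phi> p = indicator ({0..1} \<times> R) p *\<^sub>R G (w (fst p) *s snd p)" for p :: "real \<times> (complex ^ 'n)"
  have \<Phi>: "\<Phi> (\<theta>, z) = indicator {0..1} \<theta> *\<^sub>R K (w \<theta> *s z)" for \<theta> z
    by (simp add: \<Phi>_def K_def indicator_def wR)
  have K: "integrable lborel K" and IK: "integral\<^sup>L (lebesgue_on R) G = integral\<^sup>L lborel K"
    using integrable_lebesgue_on_open[OF R(1) Gc] integral_lebesgue_on_open[OF R(1) Gc] int
    unfolding K_def[abs_def] G_def[abs_def] by auto
  have [measurable]: "K \<in> borel_measurable borel" using borel_measurable_integrable[OF K] by simp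
  have inv: "integrable lborel (\<lambda>z. F (w \<theta> *s z))" "(LINT z|lborel. F (w \<theta> *s z)) = (LINT z|lborel. F z)"
    if F: "integrable lborel F" for F :: "complex ^ 'n \<Rightarrow> 'b::{banach, second_countable_topology}" and \<theta>
  proof -
    have "linear (\<lambda>z. w \<theta> *s z :: complex ^ 'n)"
      by (rule linearI) (simp_all add: vec_eq_iff algebra_simps)
    then have d: "distr lborel borel (\<lambda>z. w \<theta> *s z) = (lborel :: (complex ^ 'n) measure)"
      by (rule lborel_distr_isometry) (simp add: norm_vscale w)
    have [measurable]: "(\<lambda>z. w \<theta> *s z :: complex ^ 'n) \<in> borel_measurable borel"
      by (intro borel_measurable_continuous_onI continuous_intros)
    have [measurable]: "F \<in> borel_measurable borel" using borel_measurable_integrable[OF F] by simp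
    show "integrable lborel (\<lambda>z. F (w \<theta> *s z))"
      using F by (subst (asm) d[symmetric], subst (asm) integrable_distr_eq) auto
    show "(LINT z|lborel. F (w \<theta> *s z)) = (LINT z|lborel. F z)"
      by (subst (2) d[symmetric], subst integral_distr) auto
  qed
  have \<Phi>m: "\<Phi> \<in> borel_measurable (lborel \<Otimes>\<^sub>M lborel)"
  proof -
    have "continuous_on ({0..1} \<times> R) (\<lambda>p. G (w (fst p) *s snd p))"
      by (rule continuous_on_compose2[OF Gc]) (auto intro!: continuous_intros continuous_on_compose2[OF wc] simp: wR)
    moreover have "{0..1::real} \<times> R \<in> sets borel"
      by (rule borel_Times) (auto simp: borel_open R)
    ultimately have "\<Phi> \<in> borel_measurable borel"
      unfolding \<Phi>_def[abs_def] by (rule borel_measurable_continuous_on_indicator[rotated])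
    then show ?thesis by (simp add: lborel_prod)
  qed
  have \<Phi>i: "integrable (lborel \<Otimes>\<^sub>M lborel) \<Phi>"
  proof (rule lborel_pair.Fubini_integrable[OF \<Phi>m])
    \<comment> \<open>By invariance the inner integral of the norm is constant for \<theta> in
      [0, 1], hence integrable.\<close>
    have "(LINT z|lborel. norm (\<Phi> (\<theta>, z))) = indicator {0..1} \<theta> *\<^sub>R (LINT z|lborel. norm (K z))" for \<theta>
      using inv(2)[of "\<lambda>z. norm (K z)" \<theta>] K by (simp add: \<Phi>)
    moreover have "integrable lborel (\<lambda>\<theta>::real. indicator {0..1} \<theta> *\<^sub>R (LINT z|lborel. norm (K z)))"
      by (rule borel_integrable_compact) auto
    ultimately show "integrable lborel (\<lambda>\<theta>. LINT z|lborel. norm (\<Phi> (\<theta>, z)))" by simp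
    show "AE \<theta> in lborel. integrable lborel (\<lambda>z. \<Phi> (\<theta>, z))"
      by (auto simp: \<Phi> intro!: inv K)
  qed
  have "integral\<^sup>L lborel K = (LINT \<theta>|lborel. indicator {0..1::real} \<theta> *\<^sub>R integral\<^sup>L lborel K)"
  proof -
    have "has_bochner_integral lborel (\<lambda>\<theta>::real. indicator {0..1} \<theta> *\<^sub>R integral\<^sup>L lborel K)
        (measure lborel {0..1::real} *\<^sub>R integral\<^sup>L lborel K)"
      by (intro has_bochner_integral_scaleR_left has_bochner_integral_real_indicator) auto
    from has_bochner_integral_integral_eq[OF this] show ?thesis by simp
  qed
  also have "\<dots> = (LINT \<theta>|lborel. LINT z|lborel. \<Phi> (\<theta>, z))"
    using inv(2)[OF K] by (simp add: \<Phi>)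
  also have "\<dots> = (LINT z|lborel. LINT \<theta>|lborel. \<Phi> (\<theta>, z))"
    using lborel_pair.Fubini_integral[of "curry \<Phi>"] \<Phi>i by simp
  also have "\<dots> = (LINT z::complex ^ 'n|lborel. 0)"
  proof (rule Bochner_Integration.integral_cong[OF refl])
    fix z :: "complex ^ 'n"
    show "(LINT \<theta>|lborel. \<Phi> (\<theta>, z)) = 0"
    proof (cases "z \<in> R")
      case False
      then show ?thesis by (simp add: \<Phi>_def)
    next
      case True
      \<comment> \<open>The weight of g enters conjugated, because it is moved inside the conjugate
        on H. On the unit circle the factor is u^m / u^N; the remaining u of
        \<open>u ^ Suc N\<close> cancels against the derivative of the path.\<close>
      define q where "q \<theta> = w \<theta> ^ b * cnj (w \<theta>) ^ a * H (w \<theta> *s z)" for \<theta>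
      have qc: "continuous_on {0..1} q"
        unfolding q_def using True
        by (intro continuous_intros continuous_on_compose2[OF H] wc) (auto simp: wR)
      have "contour_integral (circlepath 0 1) (\<lambda>u. H (u *s z) * u ^ m / u ^ Suc N) =
          integral {0..1} (\<lambda>\<theta>. 2 * of_real pi * \<i> * q \<theta>)"
        unfolding contour_integral_integral
      proof (rule integral_cong)
        fix \<theta> :: real
        have w0: "w \<theta> \<noteq> 0" using w[of \<theta>] by auto
        have wi: "cnj (w \<theta>) = inverse (w \<theta>)"
          using inverse_unique[of "w \<theta>" "cnj (w \<theta>)"] complex_norm_square[of "w \<theta>"] w[of \<theta>] by simp
        have "w \<theta> ^ m * w \<theta> ^ a = w \<theta> ^ N * w \<theta> ^ b"
          using m by (simp flip: power_add)
        then have "w \<theta> ^ m / w \<theta> ^ N = w \<theta> ^ b * cnj (w \<theta>) ^ a"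
          using w0 unfolding wi by (simp add: field_simps)
        moreover have "circlepath 0 1 \<theta> = w \<theta>" by (simp add: circlepath w_def)
        moreover have "vector_derivative (circlepath 0 1) (at \<theta>) = 2 * of_real pi * \<i> * w \<theta>"
          by (simp add: vector_derivative_circlepath w_def)
        ultimately show "H (circlepath 0 1 \<theta> *s z) * circlepath 0 1 \<theta> ^ m / circlepath 0 1 \<theta> ^ Suc N *
            vector_derivative (circlepath 0 1) (at \<theta>) = 2 * of_real pi * \<i> * q \<theta>"
          using w0 by (simp add: q_def field_simps)
      qed
      then have q0: "integral {0..1} q = 0" using zero[OF True] by simp
      have qi: "integrable lborel (\<lambda>\<theta>. indicator {0..1} \<theta> *\<^sub>R q \<theta>)"
        by (rule borel_integrable_compact[OF _ qc]) simp
      have "(LINT \<theta>|lborel. indicator {0..1} \<theta> *\<^sub>R q \<theta>) = 0"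
        using set_borel_integral_eq_integral(2)[of "{0..1}" q] qi q0
        by (simp add: set_integrable_def set_lebesgue_integral_def)
      moreover have "\<Phi> (\<theta>, z) = g z * cnj (indicator {0..1} \<theta> *\<^sub>R q \<theta>)" for \<theta>
        using True wt[OF w[of \<theta>], of z] by (simp add: \<Phi>_def G_def q_def indicator_def mult_ac)
      ultimately show ?thesis by (simp del: complex_cnj_scaleR)
    qed
  qed
  finally show ?thesis using IK by (simp add: G_def[abs_def])
qed

section \<open>Square-integrable functions and the Bergman projection\<close>

text \<open>Square integrability without \<open>extensional\<close>, so that polynomials on all of
  the space and pointwise operations are usable before restriction to R.\<close>

definition sq_integrable :: "(complex ^ 'n) set \<Rightarrow> (complex ^ 'n \<Rightarrow> complex) \<Rightarrow> bool" where
  "sq_integrable R f \<longleftrightarrow>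
     f \<in> borel_measurable (lebesgue_on R) \<and> integrable (lebesgue_on R) (\<lambda>z. (cmod (f z))\<^sup>2)"

lemma sq_integrable_mult_cnj:
  assumes "sq_integrable R f" "sq_integrable R g"
  shows "integrable (lebesgue_on R) (\<lambda>z. f z * cnj (g z))"
proof (rule Bochner_Integration.integrable_bound)
  show "integrable (lebesgue_on R) (\<lambda>z. (cmod (f z))\<^sup>2 + (cmod (g z))\<^sup>2)"
    using assms by (auto simp: sq_integrable_def)
  have [measurable]: "f \<in> borel_measurable (lebesgue_on R)" "g \<in> borel_measurable (lebesgue_on R)"
    using assms by (auto simp: sq_integrable_def)
  have [measurable]: "cnj \<in> borel_measurable borel"
    by (intro borel_measurable_continuous_onI continuous_on_cnj continuous_on_id)
  show "(\<lambda>z. f z * cnj (g z)) \<in> borel_measurable (lebesgue_on R)"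
    by measurable
  have "a * b \<le> a\<^sup>2 + b\<^sup>2" if "0 \<le> a" "0 \<le> b" for a b :: real
    using sum_squares_bound[of a b] that mult_nonneg_nonneg[OF that] by linarith
  then show "AE z in lebesgue_on R. cmod (f z * cnj (g z)) \<le> norm ((cmod (f z))\<^sup>2 + (cmod (g z))\<^sup>2)"
    by (intro always_eventually) (simp add: norm_mult)
qed

lemma sq_integrable_scale: "sq_integrable R f \<Longrightarrow> sq_integrable R (\<lambda>z. c * f z)"
  unfolding sq_integrable_def by (auto simp: norm_mult power_mult_distrib)

lemma sq_integrable_add:
  assumes f: "sq_integrable R f" and g: "sq_integrable R g"
  shows "sq_integrable R (\<lambda>z. f z + g z)"
proof -
  have [measurable]: "f \<in> borel_measurable (lebesgue_on R)" "g \<in> borel_measurable (lebesgue_on R)"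
    using assms by (auto simp: sq_integrable_def)
  have "integrable (lebesgue_on R) (\<lambda>z. (cmod (f z + g z))\<^sup>2)"
  proof (rule Bochner_Integration.integrable_bound)
    show "integrable (lebesgue_on R) (\<lambda>z. 2 * (cmod (f z))\<^sup>2 + 2 * (cmod (g z))\<^sup>2)"
      using assms by (auto simp: sq_integrable_def)
    have "(cmod (a + b))\<^sup>2 \<le> 2 * (cmod a)\<^sup>2 + 2 * (cmod b)\<^sup>2" for a b
    proof -
      have "(cmod (a + b))\<^sup>2 \<le> (cmod a + cmod b)\<^sup>2"
        by (intro power_mono norm_triangle_ineq) simp
      also have "\<dots> \<le> 2 * (cmod a)\<^sup>2 + 2 * (cmod b)\<^sup>2"
        using sum_squares_bound[of "cmod a" "cmod b"] by (simp add: power2_sum)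
      finally show ?thesis .
    qed
    then show "AE z in lebesgue_on R. norm ((cmod (f z + g z))\<^sup>2) \<le> norm (2 * (cmod (f z))\<^sup>2 + 2 * (cmod (g z))\<^sup>2)"
      by (intro always_eventually) simp
  qed measurable
  then show ?thesis unfolding sq_integrable_def by simp
qed

lemma sq_integrable_diff: "sq_integrable R f \<Longrightarrow> sq_integrable R g \<Longrightarrow> sq_integrable R (\<lambda>z. f z - g z)"
  using sq_integrable_add[OF _ sq_integrable_scale[of R g "-1"]] by simp

lemma sq_integrable_sum:
  "(\<And>i. i \<in> I \<Longrightarrow> sq_integrable R (f i)) \<Longrightarrow> sq_integrable R (\<lambda>z. \<Sum>i\<in>I. f i z)"
  by (induction I rule: infinite_finite_induct)
    (auto intro: sq_integrable_add simp: sq_integrable_def[of R "\<lambda>z. 0"])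

lemma sq_integrable_cong:
  "(\<And>z. z \<in> R \<Longrightarrow> f z = g z) \<Longrightarrow> sq_integrable R f \<longleftrightarrow> sq_integrable R g"
  unfolding sq_integrable_def
  by (intro conj_cong measurable_cong Bochner_Integration.integrable_cong) auto

lemma sq_integrable_restrict: "sq_integrable R (restrict f R) \<longleftrightarrow> sq_integrable R f"
  by (rule sq_integrable_cong) simp

lemma sq_integrable_continuous:
  assumes R: "open R" "bounded R" and f: "continuous_on UNIV f"
  shows "sq_integrable R f"
proof -
  have meas: "f \<in> borel_measurable (lebesgue_on R)"
    by (rule continuous_imp_measurable_on_sets_lebesgue[OF continuous_on_subset[OF f]])
      (auto simp: sets_lebesgue_open R)
  have "compact (f ` closure R)"
    by (intro compact_continuous_image continuous_on_subset[OF f]) (auto simp: R)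
  then obtain C where "\<forall>y\<in>f ` closure R. cmod y \<le> C"
    using compact_imp_bounded[of "f ` closure R"] unfolding bounded_iff by blast
  then have C: "cmod (f z) \<le> C" if "z \<in> R" for z using that closure_subset[of R] by auto
  interpret finite_measure "lebesgue_on R"
    using R by (intro finite_measure_lebesgue_on lmeasurable_open)
  have "integrable (lebesgue_on R) (\<lambda>z. (cmod (f z))\<^sup>2)"
    by (rule integrable_const_bound[where B = "C\<^sup>2"])
      (use meas in \<open>auto intro!: AE_I2 power_mono C\<close>)
  then show ?thesis using meas by (simp add: sq_integrable_def)
qed

lemma L2_space_iff: "f \<in> L2_space R \<longleftrightarrow> f \<in> extensional R \<and> sq_integrable R f"
  by (auto simp: L2_space_def sq_integrable_def)

lemma restrict_L2_space_iff: "restrict f R \<in> L2_space R \<longleftrightarrow> sq_integrable R f"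
  unfolding L2_space_iff by (simp add: sq_integrable_restrict)

lemma L2_inner_cong:
  "(\<And>z. z \<in> R \<Longrightarrow> f z = f' z) \<Longrightarrow> (\<And>z. z \<in> R \<Longrightarrow> g z = g' z) \<Longrightarrow> L2_inner R f g = L2_inner R f' g'"
  unfolding L2_inner_def by (intro Bochner_Integration.integral_cong) auto

lemma L2_inner_restrict: "L2_inner R f (restrict g R) = L2_inner R f g"
  by (rule L2_inner_cong) simp_all

lemma L2_inner_diff_left:
  "sq_integrable R f \<Longrightarrow> sq_integrable R g \<Longrightarrow> sq_integrable R h \<Longrightarrow>
    L2_inner R (\<lambda>z. f z - g z) h = L2_inner R f h - L2_inner R g h"
  unfolding L2_inner_def
  by (simp add: left_diff_distrib sq_integrable_mult_cnj)

lemma L2_inner_scale_left: "L2_inner R (\<lambda>z. c * f z) h = c * L2_inner R f h"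
  unfolding L2_inner_def by (simp add: mult.assoc)

lemma L2_inner_add_right:
  "sq_integrable R f \<Longrightarrow> sq_integrable R g \<Longrightarrow> sq_integrable R h \<Longrightarrow>
    L2_inner R f (\<lambda>z. g z + h z) = L2_inner R f g + L2_inner R f h"
  unfolding L2_inner_def
  by (simp add: distrib_left sq_integrable_mult_cnj)

lemma L2_inner_sum_left:
  assumes "\<And>i. i \<in> I \<Longrightarrow> sq_integrable R (m i)" "sq_integrable R f"
  shows "L2_inner R (\<lambda>z. \<Sum>i\<in>I. c i * m i z) f = (\<Sum>i\<in>I. c i * L2_inner R (m i) f)"
proof -
  have "L2_inner R (\<lambda>z. \<Sum>i\<in>I. c i * m i z) f =
      integral\<^sup>L (lebesgue_on R) (\<lambda>z. \<Sum>i\<in>I. c i * (m i z * cnj (f z)))"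
    unfolding L2_inner_def by (simp add: sum_distrib_right mult.assoc)
  also have "\<dots> = (\<Sum>i\<in>I. integral\<^sup>L (lebesgue_on R) (\<lambda>z. c i * (m i z * cnj (f z))))"
    by (intro Bochner_Integration.integral_sum integrable_mult_right sq_integrable_mult_cnj) (use assms in auto)
  finally show ?thesis by (simp add: L2_inner_def)
qed

lemma L2_inner_cnj: "L2_inner R g f = cnj (L2_inner R f g)"
  unfolding L2_inner_def by (subst Bochner_Integration.integral_cnj[symmetric]) (simp add: mult.commute)

lemma L2_inner_sum_right:
  assumes "\<And>i. i \<in> I \<Longrightarrow> sq_integrable R (m i)" "sq_integrable R f"
  shows "L2_inner R f (\<lambda>z. \<Sum>i\<in>I. c i * m i z) = (\<Sum>i\<in>I. cnj (c i) * L2_inner R f (m i))"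
  by (subst (1 2) L2_inner_cnj) (simp add: L2_inner_sum_left[OF assms])

lemma L2_inner_self_eq_0:
  assumes f: "sq_integrable R f" and 0: "L2_inner R f f = 0"
  shows "AE z in lebesgue_on R. f z = 0"
proof -
  have int: "integrable (lebesgue_on R) (\<lambda>z. (cmod (f z))\<^sup>2)"
    using f by (simp add: sq_integrable_def)
  have "L2_inner R f f = of_real (integral\<^sup>L (lebesgue_on R) (\<lambda>z. (cmod (f z))\<^sup>2))"
    unfolding L2_inner_def by (simp flip: complex_norm_square integral_complex_of_real)
  with 0 have "integral\<^sup>L (lebesgue_on R) (\<lambda>z. (cmod (f z))\<^sup>2) = 0" by simp
  then show ?thesis
    by (subst (asm) integral_nonneg_eq_0_iff_AE[OF int]) auto
qed

lemma L2_inner_degenerate: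
  assumes f: "sq_integrable R f" and 0: "L2_inner R f f = 0"
  shows "L2_inner R g f = 0"
  unfolding L2_inner_def
  by (rule integral_eq_zero_AE) (use L2_inner_self_eq_0[OF assms] in eventually_elim, simp)

text \<open>Gram-Schmidt, where a new function that is null modulo the previous ones needs no correction.\<close>

lemma orthogonal_projection_finite_span:
  assumes "finite I" "\<And>i. i \<in> I \<Longrightarrow> sq_integrable R (m i)" "sq_integrable R f"
  shows "\<exists>c. \<forall>i\<in>I. L2_inner R (\<lambda>z. f z - (\<Sum>j\<in>I. c j * m j z)) (m i) = 0"
  using assms
proof (induction I arbitrary: f rule: finite_induct)
  case (insert i I)
  have m: "sq_integrable R (m j)" if "j \<in> insert i I" for j using insert.prems that by auto
  obtain d where d: "\<And>j. j \<in> I \<Longrightarrow> L2_inner R (\<lambda>z. m i z - (\<Sum>j\<in>I. d j * m j z)) (m j) = 0"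
    using insert.IH[of "m i"] m by auto
  obtain c where c: "\<And>j. j \<in> I \<Longrightarrow> L2_inner R (\<lambda>z. f z - (\<Sum>j\<in>I. c j * m j z)) (m j) = 0"
    using insert.IH[of f] m insert.prems by auto
  define g where "g z = m i z - (\<Sum>j\<in>I. d j * m j z)" for z
  define f0 where "f0 z = f z - (\<Sum>j\<in>I. c j * m j z)" for z
  \<comment> \<open>m i splits as g + s, so orthogonality of e to m i follows from orthogonality to
    g and to the span of the previous functions.\<close>
  define s where "s z = (\<Sum>j\<in>I. d j * m j z)" for z
  have sq: "sq_integrable R g" "sq_integrable R f0" "sq_integrable R s"
    unfolding g_def[abs_def] f0_def[abs_def] s_def[abs_def]
    by (intro sq_integrable_diff sq_integrable_sum sq_integrable_scale m insert.prems; simp)+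
  \<comment> \<open>For a null g the quotient is 0 by convention and e is f0, which is orthogonal to
    g by \<open>L2_inner_degenerate\<close>.\<close>
  define a where "a = L2_inner R f0 g / L2_inner R g g"
  define e where "e z = f0 z - a * g z" for z
  have e: "sq_integrable R e" unfolding e_def[abs_def] by (intro sq_integrable_diff sq_integrable_scale sq)
  have ij: "L2_inner R e (m j) = 0" if "j \<in> I" for j
    unfolding e_def using that c[OF that] d[OF that] m
    by (subst L2_inner_diff_left) (auto simp: L2_inner_scale_left sq sq_integrable_scale simp flip: g_def f0_def)
  have "L2_inner R e s = 0"
    unfolding s_def using ij m by (subst L2_inner_sum_right) (auto simp: e)
  moreover have "L2_inner R e g = 0"
  proof (cases "L2_inner R g g = 0")
    case True
    then show ?thesis by (rule L2_inner_degenerate[OF sq(1)])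
  next
    case False
    then have "a * L2_inner R g g = L2_inner R f0 g" by (simp add: a_def)
    then show ?thesis unfolding e_def
      by (subst L2_inner_diff_left) (auto simp: L2_inner_scale_left sq sq_integrable_scale)
  qed
  ultimately have "L2_inner R e (\<lambda>z. g z + s z) = 0" by (simp add: L2_inner_add_right e sq)
  moreover have "(\<lambda>z. g z + s z) = m i" by (simp add: g_def s_def)
  ultimately have ii: "L2_inner R e (m i) = 0" by (simp only:)
  \<comment> \<open>The coefficients of f0 - a g after expanding g in the original
    functions.\<close>
  define c' where "c' j = (if j = i then a else c j - a * d j)" for j
  have "f z - (\<Sum>j\<in>insert i I. c' j * m j z) = e z" for z
  proof -
    have "(\<Sum>j\<in>I. c' j * m j z) = (\<Sum>j\<in>I. (c j - a * d j) * m j z)"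
      using insert.hyps by (intro sum.cong) (auto simp: c'_def)
    also have "\<dots> = (\<Sum>j\<in>I. c j * m j z) - a * (\<Sum>j\<in>I. d j * m j z)"
      by (simp add: left_diff_distrib sum_subtractf sum_distrib_left mult.assoc)
    finally show ?thesis
      using insert.hyps by (simp add: c'_def e_def f0_def g_def algebra_simps)
  qed
  then have "(\<lambda>z. f z - (\<Sum>j\<in>insert i I. c' j * m j z)) = e" by (rule ext)
  moreover have "\<forall>k\<in>insert i I. L2_inner R e (m k) = 0" using ii ij by blast
  ultimately have "\<forall>k\<in>insert i I. L2_inner R (\<lambda>z. f z - (\<Sum>j\<in>insert i I. c' j * m j z)) (m k) = 0"
    by (simp only:)
  then show ?case by (rule exI[of _ c'])
qed auto

section \<open>Closure properties of holomorphy, and uniqueness of the projection\<close>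

lemma holomorphic_on_Cn_diff:
  assumes f: "holomorphic_on_Cn f R" and g: "holomorphic_on_Cn g R"
  shows "holomorphic_on_Cn (\<lambda>z. f z - g z) R"
  unfolding holomorphic_on_Cn_def
proof
  fix z assume "z \<in> R"
  then obtain f' g' where
    d: "(f has_derivative f') (at z within R)" "(g has_derivative g') (at z within R)" and
    l: "\<And>c v. f' (c *s v) = c * f' v" "\<And>c v. g' (c *s v) = c * g' v"
    using f g unfolding holomorphic_on_Cn_def by metis
  show "\<exists>h'. ((\<lambda>z. f z - g z) has_derivative h') (at z within R) \<and> (\<forall>c v. h' (c *s v) = c * h' v)"
    by (rule exI, rule conjI, rule has_derivative_diff[OF d]) (simp add: l algebra_simps)
qed

lemma holomorphic_on_Cn_const: "holomorphic_on_Cn (\<lambda>z. c) R"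
  unfolding holomorphic_on_Cn_def by (auto intro!: exI[of _ "\<lambda>v. 0"])

lemma holomorphic_on_Cn_nth: "holomorphic_on_Cn (\<lambda>z. z $ j) R"
  unfolding holomorphic_on_Cn_def
  by (auto intro!: exI[of _ "\<lambda>v. v $ j"] bounded_linear_imp_has_derivative bounded_linear_vec_nth)

lemma holomorphic_on_Cn_add:
  "holomorphic_on_Cn f R \<Longrightarrow> holomorphic_on_Cn g R \<Longrightarrow> holomorphic_on_Cn (\<lambda>z. f z + g z) R"
  using holomorphic_on_Cn_diff[of f R "\<lambda>z. 0 - g z"] holomorphic_on_Cn_diff[of "\<lambda>z. 0" R g]
  by (simp add: holomorphic_on_Cn_const)

lemma holomorphic_on_Cn_mult:
  assumes f: "holomorphic_on_Cn f R" and g: "holomorphic_on_Cn g R"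
  shows "holomorphic_on_Cn (\<lambda>z. f z * g z) R"
  unfolding holomorphic_on_Cn_def
proof
  fix z assume "z \<in> R"
  then obtain f' g' where
    d: "(f has_derivative f') (at z within R)" "(g has_derivative g') (at z within R)" and
    l: "\<And>c v. f' (c *s v) = c * f' v" "\<And>c v. g' (c *s v) = c * g' v"
    using f g unfolding holomorphic_on_Cn_def by metis
  show "\<exists>h'. ((\<lambda>z. f z * g z) has_derivative h') (at z within R) \<and> (\<forall>c v. h' (c *s v) = c * h' v)"
    by (rule exI, rule conjI, rule has_derivative_mult[OF d]) (simp add: l algebra_simps)
qed

lemma holomorphic_on_Cn_sum:
  "(\<And>i. i \<in> I \<Longrightarrow> holomorphic_on_Cn (f i) R) \<Longrightarrow> holomorphic_on_Cn (\<lambda>z. \<Sum>i\<in>I. f i z) R"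
  by (induction I rule: infinite_finite_induct)
    (auto intro: holomorphic_on_Cn_add holomorphic_on_Cn_const)

lemma holomorphic_on_Cn_power: "holomorphic_on_Cn f R \<Longrightarrow> holomorphic_on_Cn (\<lambda>z. f z ^ k) R"
  by (induction k) (auto intro: holomorphic_on_Cn_mult holomorphic_on_Cn_const)

lemma holomorphic_on_Cn_prod:
  "(\<And>i. i \<in> I \<Longrightarrow> holomorphic_on_Cn (f i) R) \<Longrightarrow> holomorphic_on_Cn (\<lambda>z. \<Prod>i\<in>I. f i z) R"
  by (induction I rule: infinite_finite_induct)
    (auto intro: holomorphic_on_Cn_mult holomorphic_on_Cn_const)

lemma holomorphic_on_Cn_polynomial:
  "f \<in> graded_span hol_monom mdeg N \<Longrightarrow> holomorphic_on_Cn f R"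
  unfolding graded_span_def hol_monom_def
  by (auto intro!: holomorphic_on_Cn_sum holomorphic_on_Cn_mult holomorphic_on_Cn_prod
      holomorphic_on_Cn_power holomorphic_on_Cn_const holomorphic_on_Cn_nth)

lemma holomorphic_on_Cn_cong:
  assumes "\<And>z. z \<in> R \<Longrightarrow> f z = g z" "holomorphic_on_Cn f R"
  shows "holomorphic_on_Cn g R"
  using assms unfolding holomorphic_on_Cn_def by (metis has_derivative_transform)

lemma continuous_on_conj_polynomial:
  "f \<in> graded_span conj_monom mdeg2 N \<Longrightarrow> continuous_on S f"
  unfolding graded_span_def conj_monom_def hol_monom_def case_prod_unfold
  by (auto intro!: continuous_intros)

lemma bergman_space_iff:
  "f \<in> bergman_space R \<longleftrightarrow> f \<in> extensional R \<and> sq_integrable R f \<and> holomorphic_on_Cn f R"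
  by (auto simp: bergman_space_def L2_space_iff)

lemma restrict_bergman_space:
  "sq_integrable R f \<Longrightarrow> holomorphic_on_Cn f R \<Longrightarrow> restrict f R \<in> bergman_space R"
  unfolding bergman_space_iff
  by (auto intro: holomorphic_on_Cn_cong[of R f] simp: sq_integrable_restrict)

text \<open>The set where d is nonzero is open, and a nonempty open set is not negligible. This
  turns uniqueness almost everywhere into uniqueness of functions.\<close>

lemma AE_eq_0_open_imp_eq_0:
  fixes d :: "'a::euclidean_space \<Rightarrow> complex"
  assumes R: "open R" and d: "continuous_on R d" and AE: "AE z in lebesgue_on R. d z = 0" and z: "z \<in> R"
  shows "d z = 0"
proof (rule ccontr)
  assume "d z \<noteq> 0"
  define W where "W = {z \<in> R. d z \<noteq> 0}"
  have "open W"
  proof -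
    have "open (R \<inter> d -` (- {0}))" by (intro continuous_open_preimage d R) auto
    moreover have "R \<inter> d -` (- {0}) = W" by (auto simp: W_def)
    ultimately show ?thesis by simp
  qed
  moreover have "W \<noteq> {}" using z \<open>d z \<noteq> 0\<close> by (auto simp: W_def)
  moreover have "negligible W"
  proof -
    have "AE z in lebesgue. z \<in> R \<longrightarrow> d z = 0"
      using AE sets_lebesgue_open[OF R] by (subst (asm) AE_restrict_space_iff) auto
    then obtain N where "N \<in> null_sets lebesgue" "{z. \<not> (z \<in> R \<longrightarrow> d z = 0)} \<subseteq> N"
      by (auto simp: eventually_ae_filter)
    then show ?thesis
      unfolding negligible_iff_null_sets[symmetric]
      by (elim negligible_subset) (auto simp: W_def)
  qed
  ultimately show False using open_not_negligible by blast
qed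

text \<open>Evaluates the \<open>THE\<close>: the difference of two candidates is itself, after
  restriction, in the Bergman space, hence orthogonal to itself and null, and by continuity zero on
  R.\<close>

lemma bergman_projection_eqI:
  assumes R: "open R" and f: "f \<in> L2_space R" and g: "g \<in> bergman_space R"
    and orth: "\<And>h. h \<in> bergman_space R \<Longrightarrow> L2_inner R (\<lambda>z. f z - g z) h = 0"
  shows "bergman_projection R f = g"
proof -
  have uniq: "g' = g" if g': "g' \<in> bergman_space R"
    and orth': "\<And>h. h \<in> bergman_space R \<Longrightarrow> L2_inner R (\<lambda>z. f z - g' z) h = 0" for g'
  proof -
    have sq: "sq_integrable R f" "sq_integrable R g" "sq_integrable R g'"
      using f g g' by (auto simp: bergman_space_iff L2_space_iff)
    define d where "d = (\<lambda>z. g' z - g z)"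
    have d: "sq_integrable R d" "holomorphic_on_Cn d R"
      using g g' unfolding d_def by (auto simp: bergman_space_iff intro: sq_integrable_diff holomorphic_on_Cn_diff)
    have 0: "L2_inner R (\<lambda>z. f z - g z) d = 0" "L2_inner R (\<lambda>z. f z - g' z) d = 0"
      using orth[OF restrict_bergman_space[OF d]] orth'[OF restrict_bergman_space[OF d]]
      by (simp_all add: L2_inner_restrict)
    have "L2_inner R d d = L2_inner R (\<lambda>z. (f z - g z) - (f z - g' z)) d"
      by (rule L2_inner_cong) (simp_all add: d_def)
    also have "\<dots> = 0"
      using 0 sq d by (subst L2_inner_diff_left) (auto intro: sq_integrable_diff)
    finally have "AE z in lebesgue_on R. d z = 0"
      by (rule L2_inner_self_eq_0[OF d(1)])
    moreover have "continuous_on R d"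
      using holomorphic_on_Cn_imp_line_holomorphic_on[OF R d(2)] by (simp add: line_holomorphic_on_def)
    ultimately have "d z = 0" if "z \<in> R" for z using AE_eq_0_open_imp_eq_0[OF R] that by blast
    then have "g' z = g z" if "z \<in> R" for z
      using that by (simp add: d_def)
    moreover have "g' \<in> extensional R" "g \<in> extensional R"
      using g g' by (simp_all add: bergman_space_iff)
    ultimately show "g' = g" by (intro extensionalityI)
  qed
  have "(THE g. g \<in> bergman_space R \<and> (\<forall>h\<in>bergman_space R. L2_inner R (\<lambda>z. f z - g z) h = 0)) = g"
  proof (rule the_equality)
    show "g \<in> bergman_space R \<and> (\<forall>h\<in>bergman_space R. L2_inner R (\<lambda>z. f z - g z) h = 0)"
      using g orth by blast
  qed (use uniq in blast)
  then show ?thesis using f by (simp add: bergman_projection_def)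
qed

section \<open>The projection of a polynomial\<close>

text \<open>T is the Taylor polynomial of h at 0. It depends on h and N only, so one T serves all
  f.\<close>

lemma conj_polynomial_orthogonal_remainder:
  assumes R: "open R" "connected R" "bounded R" "circular R" "0 \<in> R"
    and h: "h \<in> bergman_space R"
  obtains T where "T \<in> graded_span hol_monom mdeg N"
    "\<And>f. f \<in> graded_span conj_monom mdeg2 N \<Longrightarrow> L2_inner R f (\<lambda>z. h z - T z) = 0"
proof -
  obtain r where r: "r > 0" "ball 0 r \<subseteq> R"
    using R(1,5) by (meson open_contains_ball)
  have hR: "line_holomorphic_on h R"
    using h holomorphic_on_Cn_imp_line_holomorphic_on[OF R(1)] by (simp add: bergman_space_iff)
  then have hb: "line_holomorphic_on h (ball 0 r)"
    using r(2) by (rule line_holomorphic_on_subset)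
  define T where "T z = (\<Sum>k\<le>N. taylor_term h k z)" for z
  define H where "H z = h z - T z" for z
  have T: "T \<in> graded_span hol_monom mdeg N"
    unfolding T_def[abs_def]
    by (intro hol.sum) (auto intro: hol.mono taylor_term_polynomial[OF hb r(1)])
  have TR: "line_holomorphic_on T S" if "open S" for S
    using that holomorphic_on_Cn_polynomial[OF T] by (rule holomorphic_on_Cn_imp_line_holomorphic_on)
  have H: "line_holomorphic_on H R"
    unfolding H_def[abs_def] by (intro line_holomorphic_on_diff hR TR R(1))
  \<comment> \<open>T is continuous on the whole space and R is bounded, so subtracting it keeps h
    square integrable.\<close>
  have sqH: "sq_integrable R H"
    unfolding H_def[abs_def] using h TR[OF open_UNIV]
    by (auto intro!: sq_integrable_diff sq_integrable_continuous R simp: bergman_space_iff line_holomorphic_on_def)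
  \<comment> \<open>R contains the whole circle through each of its points, so the integral is
    holomorphic along lines in all of R; the Taylor remainder makes it vanish near 0.\<close>
  have zero: "contour_integral (circlepath 0 1) (\<lambda>u. H (u *s z) * u ^ m / u ^ Suc N) = 0"
    if "z \<in> R" for z m
  proof (rule line_analytic_continuation[OF R(1,2) _ R(5) _ that])
    show "(\<lambda>t. contour_integral (circlepath 0 1) (\<lambda>u. H (u *s (a + t *s v)) * u ^ m / u ^ Suc N))
        holomorphic_on {t. a + t *s v \<in> R}" for a v
      by (rule line_holomorphic_circle_integral[OF H open_line_preimage[OF R(1)]])
        (simp_all only: circular_vscale_iff[OF R(4)] mem_Collect_eq zero_less_one)
    have "contour_integral (circlepath 0 1) (\<lambda>u. H (u *s z) * u ^ m / u ^ Suc N) = 0"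
      if "z \<in> ball 0 r" for z
      using taylor_remainder_circle_integral[OF hb r(1) that, of N m] by (simp add: H_def T_def)
    then show "eventually (\<lambda>z. contour_integral (circlepath 0 1) (\<lambda>u. H (u *s z) * u ^ m / u ^ Suc N) = 0) (nhds 0)"
      by (rule eventually_nhds_ball[OF r(1), THEN eventually_mono])
  qed
  have sq: "sq_integrable R (conj_monom i)" for i
    using conj.base[of i "mdeg2 i"]
    by (intro sq_integrable_continuous R continuous_on_conj_polynomial) simp
  have monom: "L2_inner R (conj_monom i) H = 0" if "mdeg2 i \<le> N" for i
  proof -
    obtain \<alpha> \<beta> where i: "i = (\<alpha>, \<beta>)" by (cases i)
    \<comment> \<open>The degree bound enters here: it makes N - |\<alpha>| a genuine difference, so
      the exponent m = N - |\<alpha>| + |\<beta>| is correct.\<close>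
    have le: "mdeg \<alpha> \<le> N" using that by (simp add: i mdeg2_def)
    show ?thesis
      unfolding L2_inner_def
    proof (rule rotation_orthogonal[OF R(1,4) _ _ sq_integrable_mult_cnj[OF sq sqH] _ _ zero])
      show "continuous_on R (conj_monom i)"
        using conj.base[of i "mdeg2 i"] by (intro continuous_on_conj_polynomial) simp
      show "continuous_on R H" using H by (simp add: line_holomorphic_on_def)
      show "conj_monom i (w *s z) = w ^ mdeg \<alpha> * cnj w ^ mdeg \<beta> * conj_monom i z" for w z
        by (simp add: i conj_monom_def hol_monom_vscale mult_ac)
      show "(N - mdeg \<alpha> + mdeg \<beta>) + mdeg \<alpha> = N + mdeg \<beta>" using le by simp
    qed
  qed
  show thesis
  proof (rule that[OF T])
    fix f :: "complex ^ 'a \<Rightarrow> complex" assume "f \<in> graded_span conj_monom mdeg2 N"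
    then obtain c where "f = (\<lambda>z. \<Sum>i | mdeg2 i \<le> N. c i * conj_monom i z)"
      unfolding graded_span_def by auto
    then have "L2_inner R f H = (\<Sum>i | mdeg2 i \<le> N. c i * L2_inner R (conj_monom i) H)"
      using L2_inner_sum_left[OF sq sqH] by simp
    then show "L2_inner R f (\<lambda>z. h z - T z) = 0"
      using monom by (simp add: H_def[abs_def])
  qed
qed

text \<open>Orthogonality to the finite-dimensional space already implies orthogonality to the
  Bergman space, as f - p does not see Taylor remainders. Both inclusions of the theorem rest on
  it.\<close>

lemma bergman_projection_polynomial:
  assumes R: "open R" "connected R" "bounded R" "circular R" "0 \<in> R"
    and f: "f \<in> graded_span conj_monom mdeg2 N"
    and p: "p \<in> graded_span hol_monom mdeg N"
    and orth: "\<And>q. q \<in> graded_span hol_monom mdeg N \<Longrightarrow> L2_inner R (\<lambda>z. f z - p z) q = 0"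
  shows "bergman_projection R (restrict f R) = restrict p R"
proof (rule bergman_projection_eqI[OF R(1)])
  have pc: "q \<in> graded_span conj_monom mdeg2 N" if "q \<in> graded_span hol_monom mdeg N" for q :: "complex ^ 'a \<Rightarrow> complex"
    using that graded_span_hol_subset_real graded_span_real_subset_conj by blast
  have sq: "sq_integrable R q" if "q \<in> graded_span conj_monom mdeg2 N" for q
    using that by (intro sq_integrable_continuous R continuous_on_conj_polynomial)
  show "restrict f R \<in> L2_space R" by (simp add: restrict_L2_space_iff sq f)
  show "restrict p R \<in> bergman_space R"
    by (intro restrict_bergman_space sq pc p holomorphic_on_Cn_polynomial[OF p])
  fix h assume h: "h \<in> bergman_space R"
  define d where "d z = f z - p z" for z
  have d: "d \<in> graded_span conj_monom mdeg2 N"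
    unfolding d_def[abs_def] by (intro conj.diff f pc p)
  obtain T where T: "T \<in> graded_span hol_monom mdeg N"
    "\<And>f. f \<in> graded_span conj_monom mdeg2 N \<Longrightarrow> L2_inner R f (\<lambda>z. h z - T z) = 0"
    using conj_polynomial_orthogonal_remainder[OF R h] by blast
  have "sq_integrable R h" using h by (simp add: bergman_space_iff)
  \<comment> \<open>The T part vanishes by \<open>orth\<close>, the remainder part because d is a
    polynomial of degree at most N in z and its conjugate.\<close>
  have "L2_inner R d h = L2_inner R d (\<lambda>z. T z + (h z - T z))" by simp
  also have "\<dots> = L2_inner R d T + L2_inner R d (\<lambda>z. h z - T z)"
    by (intro L2_inner_add_right sq_integrable_diff sq d pc T \<open>sq_integrable R h\<close>)
  also have "\<dots> = 0"
    using orth[OF T(1)] T(2)[OF d] by (simp add: d_def[abs_def])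
  also have "L2_inner R d h = L2_inner R (\<lambda>z. restrict f R z - restrict p R z) h"
    by (rule L2_inner_cong) (simp_all add: d_def)
  finally show "L2_inner R (\<lambda>z. restrict f R z - restrict p R z) h = 0" .
qed

theorem theorem4p1:
  fixes R :: "(complex ^ 'n) set" and N :: nat
  assumes "open R" and "connected R" and "bounded R" and "circular R" and "0 \<in> R"
  shows "bergman_projection R ` poly_space R N = hol_poly_space R N"
proof (intro subset_antisym subsetI)
  fix g assume "g \<in> bergman_projection R ` poly_space R N"
  then obtain f where f: "f \<in> graded_span real_monom mdeg2 N" "g = bergman_projection R (restrict f R)"
    unfolding poly_space_eq by auto
  then have fc: "f \<in> graded_span conj_monom mdeg2 N" using graded_span_real_subset_conj by blast
  have sqf: "sq_integrable R f"
    using fc assms by (intro sq_integrable_continuous continuous_on_conj_polynomial)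
  have sqm: "sq_integrable R (hol_monom \<gamma>)" for \<gamma> :: "'n \<Rightarrow> nat"
    unfolding hol_monom_def[abs_def]
    by (intro sq_integrable_continuous assms) (auto intro!: continuous_intros)
  \<comment> \<open>The candidate for the projection comes from orthogonal projection onto the span
    of finitely many holomorphic monomials.\<close>
  obtain c where c: "\<And>\<gamma>. mdeg \<gamma> \<le> N \<Longrightarrow>
      L2_inner R (\<lambda>z. f z - (\<Sum>\<gamma> | mdeg \<gamma> \<le> N. c \<gamma> * hol_monom \<gamma> z)) (hol_monom \<gamma>) = 0"
    using orthogonal_projection_finite_span[where m = hol_monom, OF finite_mdeg_le[of N] sqm sqf] by auto
  define p where "p z = (\<Sum>\<gamma> | mdeg \<gamma> \<le> N. c \<gamma> * hol_monom \<gamma> z)" for z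
  have p: "p \<in> graded_span hol_monom mdeg N"
    unfolding graded_span_def p_def[abs_def] by auto
  have sq: "sq_integrable R (\<lambda>z. f z - p z)"
    unfolding p_def by (intro sq_integrable_diff sqf sq_integrable_sum sq_integrable_scale sqm)
  have "bergman_projection R (restrict f R) = restrict p R"
  proof (rule bergman_projection_polynomial[OF assms fc p])
    fix q :: "complex ^ 'n \<Rightarrow> complex" assume "q \<in> graded_span hol_monom mdeg N"
    then obtain d where "q = (\<lambda>z. \<Sum>\<gamma> | mdeg \<gamma> \<le> N. d \<gamma> * hol_monom \<gamma> z)"
      unfolding graded_span_def by auto
    then have "L2_inner R (\<lambda>z. f z - p z) q =
        (\<Sum>\<gamma> | mdeg \<gamma> \<le> N. cnj (d \<gamma>) * L2_inner R (\<lambda>z. f z - p z) (hol_monom \<gamma>))"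
      using L2_inner_sum_right[OF sqm sq] by simp
    also have "\<dots> = 0"
      by (rule sum.neutral) (simp add: c p_def)
    finally show "L2_inner R (\<lambda>z. f z - p z) q = 0" .
  qed
  then show "g \<in> hol_poly_space R N"
    using f(2) p unfolding hol_poly_space_eq by auto
next
  fix g assume "g \<in> hol_poly_space R N"
  then obtain p where p: "p \<in> graded_span hol_monom mdeg N" "g = restrict p R"
    unfolding hol_poly_space_eq by auto
  have pr: "p \<in> graded_span real_monom mdeg2 N"
    using p(1) graded_span_hol_subset_real by blast
  then have "p \<in> graded_span conj_monom mdeg2 N" using graded_span_real_subset_conj by blast
  \<comment> \<open>A holomorphic polynomial is its own projection: with f = p the orthogonality
    condition concerns the zero function.\<close>
  then have "bergman_projection R (restrict p R) = restrict p R"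
    by (rule bergman_projection_polynomial[OF assms _ p(1)]) (simp add: L2_inner_def)
  then show "g \<in> bergman_projection R ` poly_space R N"
    unfolding p(2) poly_space_eq using pr by (metis image_eqI)
qed

end
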